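(* Let $C$ be a higher rank graph with a finite number of identities which has no sources and is row finite. Then $\mathsf{B}(C)$ is a Boolean inverse monoid whose group of units is isomorphic to $\mathscr{G}(C)$.
   Context: Categories. $\mathbb{N}=\{0,1,2,\dots\}$. A category $C$ is regarded as a set of arrows, with the set of identities $C_o\subseteq C$; each arrow $a$ has a domain $\mathbf{d}(a)\in C_o$ and codomain $\mathbf{r}(a)\in C_o$, and $ab$ is defined exactly when $\mathbf{d}(a)=\mathbf{r}(b)$. Put $aC=\{ac : ac \text{ defined}\}$ and $XC=\bigcup_{x\in X}xC$. Higher rank graphs. A $k$-graph ($k\ge 1$) is a countable category $C$ with a functor $d\colon C\to\mathbb{N}^k$ (the degree) such that whenever $d(a)=\mathbf{m}+\mathbf{n}$ there are unique $a_1,a_2\in C$ with $a=a_1a_2$, $d(a_1)=\mathbf{m}$, $d(a_2)=\mathbf{n}$. A higher rank graph is a $k$-graph for some $k$. It has no sources if for each $e\in C_o$ and $\mathbf{m}\in\mathbb{N}^k$ there is $x\in C$ with $\mathbf{r}(x)=e$, $d(x)=\mathbf{m}$; it is row finite if for each $e\in C_o$ and $\mathbf{m}\in\mathbb{N}^k$ the set of $x\in eC$ with $d(x)=\mathbf{m}$ is finite. The monoid $\mathsf{R}(C)$. A right ideal of $C$ is a (possibly empty) subset $R$ with $RC\subseteq R$; it is finitely generated if $R=XC$ with $X$ finite. A bijective morphism $\theta\colon R_1\to R_2$ of right ideals is a bijection with $\mathbf{d}(\theta(r))=\mathbf{d}(r)$ and $\theta(rc)=\theta(r)c$ whenever $rc$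 is defined. $\mathsf{R}(C)$ is the set of all bijective morphisms between finitely generated right ideals of $C$; under the hypotheses it is an inverse monoid under composition of partial bijections, with zero the empty function. $\mathscr{G}(C)$ and $\mathsf{B}(C)$. On an inverse semigroup $S$ with zero, the natural partial order is $a\le b\Leftrightarrow a=ba^{-1}a$. A non-zero idempotent $e$ is essential if $ef\ne0$ for every non-zero idempotent $f$; $S^e$ is the inverse subsemigroup of all $s$ with $s^{-1}s$ and $ss^{-1}$ essential. The minimum group congruence $\sigma$ on an inverse semigroup is: $s\,\sigma\,t$ iff there is $z\le s,t$. Put $\mathscr{G}(C)=\mathsf{R}(C)^e/\sigma$. The Lenz congruence $\equiv$ is: $s\equiv t$ iff for each $0<x\le s$ there is a non-zero element below both $x$ and $t$, and for each $0<y\le t$ there is a non-zero element below both $y$ and $s$. Put $\mathsf{B}(C)=\mathsf{R}(C)/{\equiv}$. Boolean inverse monoids. In an inverse semigroup, $a\sim b$ (compatible) means $a^{-1}b$ and $ab^{-1}$ are idempotents. An inverse monoid with zero is distributive if each compatible pair has a join and multiplication distributes over such joins; it is Boolean if moreover its idempotents form a Boolean algebra under the natural partial order. *)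

theory Defs
  imports "HOL-Algebra.Group" "HOL-Library.Countable_Set" "HOL-Library.Function_Algebras"
begin

section \<open>Categories as sets of arrows\<close>

text \<open>
  The field \<open>cmp\<close> is total, but only its values \<open>a \<star> b\<close> with \<open>src a = trg b\<close> are meaningful.
\<close>

record 'a arrow_cat =
  arrows :: "'a set"
  ids :: "'a set"
  src :: "'a \<Rightarrow> 'a"
  trg :: "'a \<Rightarrow> 'a"
  cmp :: "'a \<Rightarrow> 'a \<Rightarrow> 'a"  (infixl \<open>\<star>\<index>\<close> 70)

locale arrow_category =
  fixes C :: "('a, 'z) arrow_cat_scheme" (structure)
  assumes ids_arrows: "ids C \<subseteq> arrows C"
    and src_ids: "a \<in> arrows C \<Longrightarrow> src C a \<in> ids C"
    and trg_ids: "a \<in> arrows C \<Longrightarrow> trg C a \<in> ids C"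
    and src_id: "e \<in> ids C \<Longrightarrow> src C e = e"
    and trg_id: "e \<in> ids C \<Longrightarrow> trg C e = e"
    and cmp_arrows: "\<lbrakk>a \<in> arrows C; b \<in> arrows C; src C a = trg C b\<rbrakk> \<Longrightarrow> a \<star> b \<in> arrows C"
    and src_cmp: "\<lbrakk>a \<in> arrows C; b \<in> arrows C; src C a = trg C b\<rbrakk> \<Longrightarrow> src C (a \<star> b) = src C b"
    and trg_cmp: "\<lbrakk>a \<in> arrows C; b \<in> arrows C; src C a = trg C b\<rbrakk> \<Longrightarrow> trg C (a \<star> b) = trg C a"
    and cmp_src: "a \<in> arrows C \<Longrightarrow> a \<star> src C a = a"
    and trg_cmp_id: "a \<in> arrows C \<Longrightarrow> trg C a \<star> a = a"
    and cmp_assoc: "\<lbrakk>a \<in> arrows C; b \<in> arrows C; c \<in> arrows C; src C a = trg C b; src C b = trg C c\<rbrakk>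
      \<Longrightarrow> (a \<star> b) \<star> c = a \<star> (b \<star> c)"


section \<open>Higher rank graphs\<close>

text \<open>
  The monoid \<open>\<nat>\<^sup>k\<close>, as the functions on \<open>nat\<close> that vanish outside \<open>{..<k}\<close>; its operations are
  the pointwise \<open>+\<close> and \<open>0\<close> of function algebras.
\<close>

definition degrees :: "nat \<Rightarrow> (nat \<Rightarrow> nat) set" where
  "degrees k = {m. \<forall>i\<ge>k. m i = 0}"

locale k_graph = arrow_category C
  for C :: "('a, 'z) arrow_cat_scheme" (structure) +
  fixes k :: nat and d :: "'a \<Rightarrow> nat \<Rightarrow> nat"
  assumes k_pos: "1 \<le> k"
    and countable_arrows: "countable (arrows C)"
    and deg_closed: "a \<in> arrows C \<Longrightarrow> d a \<in> degrees k"
    and deg_id: "e \<in> ids C \<Longrightarrow> d e = 0"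
    and deg_cmp: "\<lbrakk>a \<in> arrows C; b \<in> arrows C; src C a = trg C b\<rbrakk> \<Longrightarrow> d (a \<star> b) = d a + d b"
    and unique_factorization:
      "\<lbrakk>a \<in> arrows C; m \<in> degrees k; n \<in> degrees k; d a = m + n\<rbrakk>
        \<Longrightarrow> \<exists>!p. p \<in> arrows C \<times> arrows C \<and> src C (fst p) = trg C (snd p) \<and>
                 a = fst p \<star> snd p \<and> d (fst p) = m \<and> d (snd p) = n"

definition no_sources ::
    "('a, 'z) arrow_cat_scheme \<Rightarrow> nat \<Rightarrow> ('a \<Rightarrow> nat \<Rightarrow> nat) \<Rightarrow> bool" where
  "no_sources C k d \<longleftrightarrow>
    (\<forall>e\<in>ids C. \<forall>m\<in>degrees k. \<exists>x\<in>arrows C. trg C x = e \<and> d x = m)"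

definition row_finite ::
    "('a, 'z) arrow_cat_scheme \<Rightarrow> nat \<Rightarrow> ('a \<Rightarrow> nat \<Rightarrow> nat) \<Rightarrow> bool" where
  "row_finite C k d \<longleftrightarrow>
    (\<forall>e\<in>ids C. \<forall>m\<in>degrees k. finite {x \<in> arrows C. trg C x = e \<and> d x = m})"


section \<open>Inverse semigroups\<close>

text \<open>
  These notions need only the multiplication and the carrier of the monoid record; the inverse
  \<open>sinv\<close> is the inverse of inverse semigroup theory, not the group inverse \<open>m_inv\<close>.
\<close>

definition is_sinv :: "('s, 'z) monoid_scheme \<Rightarrow> 's \<Rightarrow> 's \<Rightarrow> bool" where
  "is_sinv S s t \<longleftrightarrow> t \<in> carrier S \<and> s \<otimes>\<^bsub>S\<^esub> t \<otimes>\<^bsub>S\<^esub> s = s \<and> t \<otimes>\<^bsub>S\<^esub> s \<otimes>\<^bsub>S\<^esub> t = t"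

definition sinv :: "('s, 'z) monoid_scheme \<Rightarrow> 's \<Rightarrow> 's" where
  "sinv S s = (THE t. is_sinv S s t)"

definition is_zero :: "('s, 'z) monoid_scheme \<Rightarrow> 's \<Rightarrow> bool" where
  "is_zero S z \<longleftrightarrow> z \<in> carrier S \<and> (\<forall>s\<in>carrier S. z \<otimes>\<^bsub>S\<^esub> s = z \<and> s \<otimes>\<^bsub>S\<^esub> z = z)"

definition idems :: "('s, 'z) monoid_scheme \<Rightarrow> 's set" where
  "idems S = {e \<in> carrier S. e \<otimes>\<^bsub>S\<^esub> e = e}"

definition nat_le :: "('s, 'z) monoid_scheme \<Rightarrow> 's \<Rightarrow> 's \<Rightarrow> bool" where
  "nat_le S a b \<longleftrightarrow> a = b \<otimes>\<^bsub>S\<^esub> sinv S a \<otimes>\<^bsub>S\<^esub> a"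

definition nat_order :: "('s, 'z) monoid_scheme \<Rightarrow> 's gorder" where
  "nat_order S = \<lparr>carrier = carrier S, eq = (=), le = nat_le S\<rparr>"

definition essential :: "('s, 'z) monoid_scheme \<Rightarrow> 's \<Rightarrow> bool" where
  "essential S e \<longleftrightarrow> e \<in> idems S \<and> \<not> is_zero S e \<and>
    (\<forall>f\<in>idems S. \<not> is_zero S f \<longrightarrow> \<not> is_zero S (e \<otimes>\<^bsub>S\<^esub> f))"

definition essential_part :: "('s, 'z) monoid_scheme \<Rightarrow> ('s, 'z) monoid_scheme" where
  "essential_part S = S\<lparr>carrier :=
    {s \<in> carrier S. essential S (sinv S s \<otimes>\<^bsub>S\<^esub> s) \<and> essential S (s \<otimes>\<^bsub>S\<^esub> sinv S s)}\<rparr>"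

definition min_group_cong :: "('s, 'z) monoid_scheme \<Rightarrow> ('s \<times> 's) set" where
  "min_group_cong S = {(s, t). s \<in> carrier S \<and> t \<in> carrier S \<and>
    (\<exists>z\<in>carrier S. nat_le S z s \<and> nat_le S z t)}"

definition meets_all_below :: "('s, 'z) monoid_scheme \<Rightarrow> 's \<Rightarrow> 's \<Rightarrow> bool" where
  "meets_all_below S s t \<longleftrightarrow>
    (\<forall>x\<in>carrier S. \<not> is_zero S x \<and> nat_le S x s \<longrightarrow>
      (\<exists>z\<in>carrier S. \<not> is_zero S z \<and> nat_le S z x \<and> nat_le S z t))"

definition lenz_cong :: "('s, 'z) monoid_scheme \<Rightarrow> ('s \<times> 's) set" where
  "lenz_cong S = {(s, t). s \<in> carrier S \<and> t \<in> carrier S \<and>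
    meets_all_below S s t \<and> meets_all_below S t s}"

text \<open>
  The quotient of a monoid by a congruence. The product of two classes is the union of the classes
  of all products of representatives, which is a single class when \<open>r\<close> is a congruence.
\<close>

definition quotient_monoid :: "('s, 'z) monoid_scheme \<Rightarrow> ('s \<times> 's) set \<Rightarrow> 's set monoid" where
  "quotient_monoid S r =
    \<lparr>carrier = carrier S // r,
     mult = (\<lambda>A B. \<Union>a\<in>A. \<Union>b\<in>B. r `` {a \<otimes>\<^bsub>S\<^esub> b}),
     one = r `` {\<one>\<^bsub>S\<^esub>}\<rparr>"


section \<open>Boolean inverse monoids\<close>

locale inverse_monoid = monoid S for S :: "('s, 'z) monoid_scheme" (structure) +
  assumes unique_sinv: "s \<in> carrier S \<Longrightarrow> \<exists>!t. is_sinv S s t"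

locale inverse_monoid_zero = inverse_monoid +
  assumes zero_exists: "\<exists>z. is_zero S z"

definition compatible :: "('s, 'z) monoid_scheme \<Rightarrow> 's \<Rightarrow> 's \<Rightarrow> bool" where
  "compatible S a b \<longleftrightarrow> sinv S a \<otimes>\<^bsub>S\<^esub> b \<in> idems S \<and> a \<otimes>\<^bsub>S\<^esub> sinv S b \<in> idems S"

definition is_join :: "('s, 'z) monoid_scheme \<Rightarrow> 's \<Rightarrow> 's \<Rightarrow> 's \<Rightarrow> bool" where
  "is_join S a b j \<longleftrightarrow> least (nat_order S) j (Upper (nat_order S) {a, b})"

locale distributive_inverse_monoid = inverse_monoid_zero +
  assumes join_exists:
      "\<lbrakk>a \<in> carrier S; b \<in> carrier S; compatible S a b\<rbrakk> \<Longrightarrow> \<exists>j. is_join S a b j"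
    and left_distrib:
      "\<lbrakk>a \<in> carrier S; b \<in> carrier S; c \<in> carrier S; compatible S a b; is_join S a b j\<rbrakk>
        \<Longrightarrow> is_join S (c \<otimes> a) (c \<otimes> b) (c \<otimes> j)"
    and right_distrib:
      "\<lbrakk>a \<in> carrier S; b \<in> carrier S; c \<in> carrier S; compatible S a b; is_join S a b j\<rbrakk>
        \<Longrightarrow> is_join S (a \<otimes> c) (b \<otimes> c) (j \<otimes> c)"

locale boolean_lattice = bounded_lattice +
  assumes meet_join_distrib:
      "\<lbrakk>x \<in> carrier L; y \<in> carrier L; z \<in> carrier L\<rbrakk>
        \<Longrightarrow> x \<sqinter> (y \<squnion> z) = (x \<sqinter> y) \<squnion> (x \<sqinter> z)"
    and complement_exists:
      "x \<in> carrier L \<Longrightarrow> \<exists>y\<in>carrier L. x \<sqinter> y = \<bottom> \<and> x \<squnion> y = \<top>"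

locale boolean_inverse_monoid = distributive_inverse_monoid +
  assumes idems_boolean: "boolean_lattice ((nat_order S)\<lparr>carrier := idems S\<rparr>)"


section \<open>The monoids associated with a category\<close>

definition ideal_gen :: "('a, 'z) arrow_cat_scheme \<Rightarrow> 'a set \<Rightarrow> 'a set" where
  "ideal_gen C X = (\<Union>x\<in>X. {x \<star>\<^bsub>C\<^esub> c | c. c \<in> arrows C \<and> src C x = trg C c})"

definition right_ideal :: "('a, 'z) arrow_cat_scheme \<Rightarrow> 'a set \<Rightarrow> bool" where
  "right_ideal C R \<longleftrightarrow> R \<subseteq> arrows C \<and> ideal_gen C R \<subseteq> R"

definition fg_right_ideal :: "('a, 'z) arrow_cat_scheme \<Rightarrow> 'a set \<Rightarrow> bool" where
  "fg_right_ideal C R \<longleftrightarrow>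
    right_ideal C R \<and> (\<exists>X. finite X \<and> X \<subseteq> arrows C \<and> R = ideal_gen C X)"

text \<open>
  Partial bijections are partial functions \<open>'a \<rightharpoonup> 'a\<close>, so that \<open>dom\<close> and \<open>ran\<close> below are their
  domain of definition and image.
\<close>

definition bij_morphism ::
    "('a, 'z) arrow_cat_scheme \<Rightarrow> 'a set \<Rightarrow> 'a set \<Rightarrow> ('a \<rightharpoonup> 'a) \<Rightarrow> bool" where
  "bij_morphism C R1 R2 \<theta> \<longleftrightarrow>
    dom \<theta> = R1 \<and> ran \<theta> = R2 \<and> inj_on \<theta> R1 \<and>
    (\<forall>r\<in>R1. src C (the (\<theta> r)) = src C r) \<and>
    (\<forall>r\<in>R1. \<forall>c\<in>arrows C. src C r = trg C c \<longrightarrow>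
      \<theta> (r \<star>\<^bsub>C\<^esub> c) = Some (the (\<theta> r) \<star>\<^bsub>C\<^esub> c))"

definition R_monoid :: "('a, 'z) arrow_cat_scheme \<Rightarrow> ('a \<rightharpoonup> 'a) monoid" where
  "R_monoid C =
    \<lparr>carrier = {\<theta>. \<exists>R1 R2. fg_right_ideal C R1 \<and> fg_right_ideal C R2 \<and> bij_morphism C R1 R2 \<theta>},
     mult = (\<circ>\<^sub>m),
     one = Some |` arrows C\<rparr>"

definition G_group :: "('a, 'z) arrow_cat_scheme \<Rightarrow> ('a \<rightharpoonup> 'a) set monoid" where
  "G_group C = (let S = essential_part (R_monoid C) in quotient_monoid S (min_group_cong S))"

definition B_monoid :: "('a, 'z) arrow_cat_scheme \<Rightarrow> ('a \<rightharpoonup> 'a) set monoid" where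
  "B_monoid C = quotient_monoid (R_monoid C) (lenz_cong (R_monoid C))"

end

theory Submission
  imports Defs
begin

text \<open>
  Say that an arrow is long when every coordinate of its degree is large, and that a property of
  arrows holds eventually when it holds for all sufficiently long arrows. The proof rests on one
  observation: two bijective morphisms \<open>s\<close> and \<open>t\<close> between finitely generated right ideals are
  Lenz congruent exactly when they eventually agree, \<open>s a = t a\<close> or both undefined
  (\<open>lenz_cong_iff\<close>). Indeed, if every restriction of \<open>s\<close> meets \<open>t\<close>, then for a long arrow \<open>a\<close> of the
  domain of \<open>s\<close> there is some \<open>ac\<close> with \<open>s(a)c = s(ac) = t(ac)\<close>; as \<open>a\<close> is longer than the generators
  of the domain of \<open>t\<close>, unique factorization puts \<open>a\<close> itself in this domain, so that
  \<open>s(a)c = t(a)c\<close>, and \<open>c\<close> can be cancelled. Conversely every arrow extends to long ones, since there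
  are no sources.

  The elements of \<open>B(C)\<close> are therefore germs at infinity of morphisms. A morphism changes degrees by
  a bounded amount, so it carries long arrows to long arrows, backwards as well as forwards
  (\<open>eventually_far_image\<close>, \<open>eventually_far_preimage\<close>). Composition, inverse, order, idempotency and
  compatibility of germs thus become eventual versions of the same notions for partial injections.

  Finiteness of the set of identities and row finiteness make the ideal \<open>tail N\<close> of all arrows of
  degree at least \<open>(N, \<dots>, N)\<close> finitely generated, so any morphism may be restricted to it without
  changing its germ. Morphisms whose germs are compatible become compatible after such a restriction, and
  their union is a morphism that represents the join; eventual equations show that multiplication distributes over it. And an ideal
  \<open>R\<close> generated in degrees at most \<open>(N, \<dots>, N)\<close> has the finitely generated complement \<open>tail N - R\<close>, so
  that the idempotents of \<open>B(C)\<close> are the finitely generated right ideals modulo eventual equality,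
  a Boolean algebra of sets modulo a filter.

  Finally, a finitely generated ideal is essential exactly when it contains all sufficiently
  long arrows. A germ is thus a unit exactly when its representatives have essential domain and range, and on such
  morphisms the minimum group congruence is again eventual equality: a common lower bound is the
  restriction to \<open>tail N\<close>. The group of units and \<open>G(C)\<close> consist of the same classes with the same
  product, and the isomorphism is the identity map.
\<close>


section \<open>Partial injections\<close>

definition partial_inj :: "('a \<rightharpoonup> 'b) \<Rightarrow> bool" where
  "partial_inj f \<longleftrightarrow> (\<forall>x x' y. f x = Some y \<longrightarrow> f x' = Some y \<longrightarrow> x = x')"

definition map_converse :: "('a \<rightharpoonup> 'b) \<Rightarrow> ('b \<rightharpoonup> 'a)" where
  "map_converse f y = (if y \<in> ran f then Some (THE x. f x = Some y) else None)"

lemma partial_injD: "\<lbrakk>partial_inj f; f x = Some y; f x' = Some y\<rbrakk> \<Longrightarrow> x = x'"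
  unfolding partial_inj_def by blast

lemma partial_inj_iff_inj_on: "partial_inj f \<longleftrightarrow> inj_on f (dom f)"
proof
  show "inj_on f (dom f)" if "partial_inj f"
    using that by (intro inj_onI) (auto dest: partial_injD)
  show "partial_inj f" if "inj_on f (dom f)"
    unfolding partial_inj_def using that by (metis domI inj_onD)
qed

lemma map_converse_eq_Some:
  assumes "partial_inj f"
  shows "map_converse f y = Some x \<longleftrightarrow> f x = Some y"
proof
  assume "map_converse f y = Some x"
  then have y: "y \<in> ran f" and x: "x = (THE x. f x = Some y)"
    unfolding map_converse_def by (auto split: if_splits)
  from y obtain x' where x': "f x' = Some y"
    unfolding ran_def by blast
  then have "(THE x. f x = Some y) = x'"
    using assms by (blast dest: partial_injD)
  with x x' show "f x = Some y" by simp
next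
  assume f: "f x = Some y"
  then have "(THE x. f x = Some y) = x"
    using assms by (blast dest: partial_injD)
  moreover from f have "y \<in> ran f" by (rule ranI)
  ultimately show "map_converse f y = Some x"
    unfolding map_converse_def by simp
qed

lemma partial_inj_converse: "partial_inj f \<Longrightarrow> partial_inj (map_converse f)"
  unfolding partial_inj_def[of "map_converse f"] by (simp add: map_converse_eq_Some)

lemma dom_map_converse: "partial_inj f \<Longrightarrow> dom (map_converse f) = ran f"
  by (auto simp: map_converse_eq_Some dom_def ran_def)

lemma ran_map_converse: "partial_inj f \<Longrightarrow> ran (map_converse f) = dom f"
  by (auto simp: map_converse_eq_Some dom_def ran_def)

lemma partial_inj_comp: "\<lbrakk>partial_inj f; partial_inj g\<rbrakk> \<Longrightarrow> partial_inj (f \<circ>\<^sub>m g)"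
  unfolding partial_inj_def map_comp_Some_iff by blast

lemma partial_inj_restrict: "partial_inj f \<Longrightarrow> partial_inj (f |` A)"
  unfolding partial_inj_def restrict_map_def by (auto split: if_splits)

lemma map_comp_assoc: "(f \<circ>\<^sub>m g) \<circ>\<^sub>m h = f \<circ>\<^sub>m (g \<circ>\<^sub>m h)"
  by (rule ext) (simp add: map_comp_def split: option.splits)

lemma converse_comp_self:
  assumes "partial_inj f"
  shows "map_converse f \<circ>\<^sub>m f = Some |` dom f"
proof
  fix x
  show "(map_converse f \<circ>\<^sub>m f) x = (Some |` dom f) x"
    by (cases "f x") (auto simp: map_comp_def map_converse_eq_Some[OF assms] restrict_map_def dom_def)
qed

lemma self_comp_converse:
  assumes "partial_inj f"
  shows "f \<circ>\<^sub>m map_converse f = Some |` ran f"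
proof
  fix y
  show "(f \<circ>\<^sub>m map_converse f) y = (Some |` ran f) y"
  proof (cases "map_converse f y")
    case None
    then have "y \<notin> ran f" by (simp flip: dom_map_converse[OF assms] add: domIff)
    with None show ?thesis by (simp add: map_comp_def restrict_map_def)
  next
    case (Some x)
    then have "f x = Some y" by (simp add: map_converse_eq_Some[OF assms])
    with Some show ?thesis by (auto simp: map_comp_def restrict_map_def ran_def)
  qed
qed

lemma comp_restrict_Some: "f \<circ>\<^sub>m (Some |` A) = f |` A"
  by (rule ext) (simp add: map_comp_def restrict_map_def)

text \<open>
  In the equations \<open>sts = s\<close> and \<open>tst = t\<close>, injectivity forces the detour through the other map to
  return to the starting point, so that \<open>t\<close> inverts \<open>s\<close> pointwise and has no further values. This
  is the uniqueness of generalized inverses in an inverse monoid of partial injections.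
\<close>
lemma partial_inj_generalized_inverse:
  assumes s: "partial_inj s" and t: "partial_inj t"
  shows "s \<circ>\<^sub>m t \<circ>\<^sub>m s = s \<and> t \<circ>\<^sub>m s \<circ>\<^sub>m t = t \<longleftrightarrow> t = map_converse s"
proof
  assume *: "s \<circ>\<^sub>m t \<circ>\<^sub>m s = s \<and> t \<circ>\<^sub>m s \<circ>\<^sub>m t = t"
  have "t y = Some x \<longleftrightarrow> s x = Some y" for x y
  proof
    assume "t y = Some x"
    moreover from this * have "(t \<circ>\<^sub>m s \<circ>\<^sub>m t) y = Some x" by simp
    ultimately obtain y' where "s x = Some y'" "t y' = Some x"
      by (auto simp: map_comp_Some_iff)
    with t \<open>t y = Some x\<close> show "s x = Some y" by (metis partial_injD)
  next
    assume "s x = Some y"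
    moreover from this * have "(s \<circ>\<^sub>m t \<circ>\<^sub>m s) x = Some y" by simp
    ultimately obtain x' where "t y = Some x'" "s x' = Some y"
      by (auto simp: map_comp_Some_iff)
    with s \<open>s x = Some y\<close> show "t y = Some x" by (metis partial_injD)
  qed
  then have "t y = map_converse s y" for y
    by (metis map_converse_eq_Some[OF s] option.exhaust)
  then show "t = map_converse s" ..
next
  assume "t = map_converse s"
  moreover have "s |` dom s = s" "map_converse s |` dom (map_converse s) = map_converse s"
    by (rule ext, simp add: restrict_map_def domIff)+
  ultimately show "s \<circ>\<^sub>m t \<circ>\<^sub>m s = s \<and> t \<circ>\<^sub>m s \<circ>\<^sub>m t = t"
    using s unfolding map_comp_assoc by (simp add: converse_comp_self self_comp_converse comp_restrict_Some
        dom_map_converse)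
qed


section \<open>Quotients by a congruence\<close>

text \<open>
  The product in the quotient is a union over all representatives, which for a congruence are all
  contained in one class; the union is not empty because the representatives \<open>a\<close> and \<open>b\<close> occur in it.
\<close>
lemma quotient_monoid_mult:
  assumes r: "equiv (carrier S) r"
    and cong: "\<And>a a' b b'. \<lbrakk>(a, a') \<in> r; (b, b') \<in> r\<rbrakk> \<Longrightarrow> (a \<otimes>\<^bsub>S\<^esub> b, a' \<otimes>\<^bsub>S\<^esub> b') \<in> r"
    and "a \<in> carrier S" "b \<in> carrier S"
  shows "(r `` {a}) \<otimes>\<^bsub>quotient_monoid S r\<^esub> (r `` {b}) = r `` {a \<otimes>\<^bsub>S\<^esub> b}"
proof -
  have "r `` {a' \<otimes>\<^bsub>S\<^esub> b'} = r `` {a \<otimes>\<^bsub>S\<^esub> b}" if "a' \<in> r `` {a}" "b' \<in> r `` {b}" for a' b'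
    using that by (metis Image_singleton_iff cong equiv_class_eq r)
  then have "(\<Union>a'\<in>r `` {a}. \<Union>b'\<in>r `` {b}. r `` {a' \<otimes>\<^bsub>S\<^esub> b'})
      = (\<Union>a'\<in>r `` {a}. \<Union>b'\<in>r `` {b}. r `` {a \<otimes>\<^bsub>S\<^esub> b})"
    by (intro SUP_cong refl)
  moreover have "a \<in> r `` {a}" "b \<in> r `` {b}"
    using equiv_class_self[OF r] assms by blast+
  ultimately show ?thesis
    unfolding quotient_monoid_def by (simp only: monoid.simps) blast
qed

lemma quotient_monoid_monoid:
  assumes "monoid S" and r: "equiv (carrier S) r"
    and cong: "\<And>a a' b b'. \<lbrakk>(a, a') \<in> r; (b, b') \<in> r\<rbrakk> \<Longrightarrow> (a \<otimes>\<^bsub>S\<^esub> b, a' \<otimes>\<^bsub>S\<^esub> b') \<in> r"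
  shows "monoid (quotient_monoid S r)"
proof -
  interpret S: monoid S by fact
  have carr: "carrier (quotient_monoid S r) = (\<lambda>a. r `` {a}) ` carrier S"
    by (auto simp: quotient_monoid_def quotient_def)
  have one: "\<one>\<^bsub>quotient_monoid S r\<^esub> = r `` {\<one>\<^bsub>S\<^esub>}"
    by (simp add: quotient_monoid_def)
  have mult: "(r `` {a}) \<otimes>\<^bsub>quotient_monoid S r\<^esub> (r `` {b}) = r `` {a \<otimes>\<^bsub>S\<^esub> b}"
    if "a \<in> carrier S" "b \<in> carrier S" for a b
    using quotient_monoid_mult[OF r cong that] .
  show ?thesis
  proof (rule monoidI, unfold carr one)
    fix x y z
    assume "x \<in> (\<lambda>a. r `` {a}) ` carrier S" "y \<in> (\<lambda>a. r `` {a}) ` carrier S"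
      "z \<in> (\<lambda>a. r `` {a}) ` carrier S"
    then obtain a b c where "x = r `` {a}" "y = r `` {b}" "z = r `` {c}"
      "a \<in> carrier S" "b \<in> carrier S" "c \<in> carrier S" by blast
    then show "x \<otimes>\<^bsub>quotient_monoid S r\<^esub> y \<in> (\<lambda>a. r `` {a}) ` carrier S"
      "x \<otimes>\<^bsub>quotient_monoid S r\<^esub> y \<otimes>\<^bsub>quotient_monoid S r\<^esub> z
        = x \<otimes>\<^bsub>quotient_monoid S r\<^esub> (y \<otimes>\<^bsub>quotient_monoid S r\<^esub> z)"
      "r `` {\<one>\<^bsub>S\<^esub>} \<otimes>\<^bsub>quotient_monoid S r\<^esub> x = x"
      "x \<otimes>\<^bsub>quotient_monoid S r\<^esub> r `` {\<one>\<^bsub>S\<^esub>} = x"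
      by (simp_all only: mult S.m_closed S.one_closed S.m_assoc S.l_one S.r_one)
        blast
  qed simp
qed


section \<open>Boolean algebras of sets modulo a filter\<close>

text \<open>
  Union and intersection respect inclusion modulo a filter, so they compute suprema and infima in the
  quotient, and distributivity is inherited. A complement has to be one only eventually along \<open>F\<close>, so
  the quotient can be Boolean although \<open>\<A>\<close> is not closed under complements.
\<close>
lemma boolean_lattice_sets_mod_filter:
  fixes L :: "'b gorder" and \<phi> :: "'i set \<Rightarrow> 'b" and \<A> :: "'i set set"
  assumes carr: "carrier L = \<phi> ` \<A>" and eqL: "eq L = (=)"
    and le: "\<And>A B. \<lbrakk>A \<in> \<A>; B \<in> \<A>\<rbrakk> \<Longrightarrow> \<phi> A \<sqsubseteq>\<^bsub>L\<^esub> \<phi> B \<longleftrightarrow> (\<forall>\<^sub>F x in F. x \<in> A \<longrightarrow> x \<in> B)"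
    and same: "\<And>A B. \<lbrakk>A \<in> \<A>; B \<in> \<A>\<rbrakk> \<Longrightarrow> \<phi> A = \<phi> B \<longleftrightarrow> (\<forall>\<^sub>F x in F. x \<in> A \<longleftrightarrow> x \<in> B)"
    and un: "\<And>A B. \<lbrakk>A \<in> \<A>; B \<in> \<A>\<rbrakk> \<Longrightarrow> A \<union> B \<in> \<A>"
    and int: "\<And>A B. \<lbrakk>A \<in> \<A>; B \<in> \<A>\<rbrakk> \<Longrightarrow> A \<inter> B \<in> \<A>"
    and empty: "{} \<in> \<A>" and top: "T \<in> \<A>" "\<forall>\<^sub>F x in F. x \<in> T"
    and compl: "\<And>A. A \<in> \<A> \<Longrightarrow> \<exists>B\<in>\<A>. \<forall>\<^sub>F x in F. x \<in> B \<longleftrightarrow> x \<notin> A"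
  shows "boolean_lattice L"
proof -
  interpret partial_order L
  proof unfold_locales
    fix x y assume "x \<in> carrier L" "y \<in> carrier L" "x \<sqsubseteq>\<^bsub>L\<^esub> y" "y \<sqsubseteq>\<^bsub>L\<^esub> x"
    then show "x .=\<^bsub>L\<^esub> y"
      unfolding carr eqL by (auto simp: le same elim: eventually_elim2)
  next
    fix x y z assume "x \<in> carrier L" "y \<in> carrier L" "z \<in> carrier L" "x \<sqsubseteq>\<^bsub>L\<^esub> y" "y \<sqsubseteq>\<^bsub>L\<^esub> z"
    then show "x \<sqsubseteq>\<^bsub>L\<^esub> z"
      unfolding carr by (auto simp: le elim: eventually_elim2)
  qed (auto simp: eqL carr le)
  have lub: "least L (\<phi> (A \<union> B)) (Upper L {\<phi> A, \<phi> B})" if "A \<in> \<A>" "B \<in> \<A>" for A B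
  proof (rule least_UpperI)
    show "x \<sqsubseteq>\<^bsub>L\<^esub> \<phi> (A \<union> B)" if "x \<in> {\<phi> A, \<phi> B}" for x
      using that \<open>A \<in> \<A>\<close> \<open>B \<in> \<A>\<close> by (auto simp: le un)
    show "\<phi> (A \<union> B) \<sqsubseteq>\<^bsub>L\<^esub> y" if y: "y \<in> Upper L {\<phi> A, \<phi> B}" for y
    proof -
      from y obtain Y where Y: "Y \<in> \<A>" "y = \<phi> Y" unfolding Upper_def carr by auto
      from y have "\<phi> A \<sqsubseteq>\<^bsub>L\<^esub> y" "\<phi> B \<sqsubseteq>\<^bsub>L\<^esub> y"
        using \<open>A \<in> \<A>\<close> \<open>B \<in> \<A>\<close> by (auto simp: Upper_def carr)
      then show ?thesis
        using that \<open>A \<in> \<A>\<close> \<open>B \<in> \<A>\<close> Y by (auto simp: le un elim: eventually_elim2)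
    qed
  qed (use that un in \<open>auto simp: carr\<close>)
  have glb: "greatest L (\<phi> (A \<inter> B)) (Lower L {\<phi> A, \<phi> B})" if "A \<in> \<A>" "B \<in> \<A>" for A B
  proof (rule greatest_LowerI)
    show "\<phi> (A \<inter> B) \<sqsubseteq>\<^bsub>L\<^esub> x" if "x \<in> {\<phi> A, \<phi> B}" for x
      using that \<open>A \<in> \<A>\<close> \<open>B \<in> \<A>\<close> by (auto simp: le int)
    show "y \<sqsubseteq>\<^bsub>L\<^esub> \<phi> (A \<inter> B)" if y: "y \<in> Lower L {\<phi> A, \<phi> B}" for y
    proof -
      from y obtain Y where Y: "Y \<in> \<A>" "y = \<phi> Y" unfolding Lower_def carr by auto
      from y have "y \<sqsubseteq>\<^bsub>L\<^esub> \<phi> A" "y \<sqsubseteq>\<^bsub>L\<^esub> \<phi> B"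
        using \<open>A \<in> \<A>\<close> \<open>B \<in> \<A>\<close> by (auto simp: Lower_def carr)
      then show ?thesis
        using that \<open>A \<in> \<A>\<close> \<open>B \<in> \<A>\<close> Y by (auto simp: le int elim: eventually_elim2)
    qed
  qed (use that int in \<open>auto simp: carr\<close>)
  have T_above: "\<forall>\<^sub>F x in F. x \<in> A \<longrightarrow> x \<in> T" for A
    using top(2) by (rule eventually_mono) simp
  interpret bounded_lattice L
  proof unfold_locales
    show "\<exists>s. least L s (Upper L {x, y})" if "x \<in> carrier L" "y \<in> carrier L" for x y
      using that lub by (auto simp: carr)
    show "\<exists>s. greatest L s (Lower L {x, y})" if "x \<in> carrier L" "y \<in> carrier L" for x y
      using that glb by (auto simp: carr)
    show "\<exists>b. least L b (carrier L)"
      using empty by (intro exI[of _ "\<phi> {}"]) (auto simp: least_def carr le)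
    show "\<exists>t. greatest L t (carrier L)"
      using top by (intro exI[of _ "\<phi> T"]) (auto simp: greatest_def carr le T_above)
  qed
  have join: "\<phi> A \<squnion>\<^bsub>L\<^esub> \<phi> B = \<phi> (A \<union> B)" if "A \<in> \<A>" "B \<in> \<A>" for A B
  proof (rule joinI)
    fix l assume "least L l (Upper L {\<phi> A, \<phi> B})"
    then show "l = \<phi> (A \<union> B)"
      using weak_least_unique[OF _ lub[OF that]] by (simp add: eqL)
  qed (use that in \<open>auto simp: carr\<close>)
  have meet: "\<phi> A \<sqinter>\<^bsub>L\<^esub> \<phi> B = \<phi> (A \<inter> B)" if "A \<in> \<A>" "B \<in> \<A>" for A B
  proof (rule meetI)
    fix l assume "greatest L l (Lower L {\<phi> A, \<phi> B})"
    then show "l = \<phi> (A \<inter> B)"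
      using weak_greatest_unique[OF _ glb[OF that]] by (simp add: eqL)
  qed (use that in \<open>auto simp: carr\<close>)
  have bot: "\<bottom>\<^bsub>L\<^esub> = \<phi> {}"
    using empty by (intro bottom_eq[symmetric]) (auto simp: carr le)
  have tp: "\<top>\<^bsub>L\<^esub> = \<phi> T"
    using top by (intro top_eq[symmetric]) (auto simp: carr le T_above)
  show ?thesis
  proof unfold_locales
    fix x y z assume "x \<in> carrier L" "y \<in> carrier L" "z \<in> carrier L"
    then show "x \<sqinter>\<^bsub>L\<^esub> (y \<squnion>\<^bsub>L\<^esub> z) = (x \<sqinter>\<^bsub>L\<^esub> y) \<squnion>\<^bsub>L\<^esub> (x \<sqinter>\<^bsub>L\<^esub> z)"
      by (auto simp: carr join meet un int Int_Un_distrib)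
  next
    fix x assume "x \<in> carrier L"
    then obtain A where A: "A \<in> \<A>" "x = \<phi> A" by (auto simp: carr)
    from compl[OF A(1)] obtain B where B: "B \<in> \<A>" "\<forall>\<^sub>F x in F. x \<in> B \<longleftrightarrow> x \<notin> A" by blast
    have "\<phi> (A \<inter> B) = \<phi> {}"
      using A B(1) empty by (simp add: same int) (rule eventually_mono[OF B(2)], simp)
    moreover have "\<phi> (A \<union> B) = \<phi> T"
      using A B(1) top(1)
      by (simp add: same un) (rule eventually_elim2[OF B(2) top(2)], simp)
    ultimately show "\<exists>y\<in>carrier L. x \<sqinter>\<^bsub>L\<^esub> y = \<bottom>\<^bsub>L\<^esub> \<and> x \<squnion>\<^bsub>L\<^esub> y = \<top>\<^bsub>L\<^esub>"
      using A B(1) by (auto simp: carr join meet bot tp)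
  qed
qed


section \<open>Factorizations in a higher rank graph\<close>

context k_graph
begin

lemma factor_exists:
  assumes "a \<in> arrows C" and "\<And>i. m i \<le> d a i"
  obtains z w where "z \<in> arrows C" "w \<in> arrows C" "src C z = trg C w" "a = z \<star> w" "d z = m"
proof -
  from assms deg_closed[of a] have "m \<in> degrees k" "(\<lambda>i. d a i - m i) \<in> degrees k"
    unfolding degrees_def by (auto, metis le_zero_eq)
  moreover have "d a = m + (\<lambda>i. d a i - m i)"
    using assms(2) by (auto simp: fun_eq_iff)
  ultimately show thesis
    using unique_factorization[OF assms(1)] that by (metis mem_Times_iff)
qed

text \<open>Degrees are cancellative, so the second factors have equal degree once the first ones do.\<close>
lemma factor_unique:
  assumes ar: "a \<in> arrows C" "b \<in> arrows C" "a' \<in> arrows C" "b' \<in> arrows C"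
    and comp: "src C a = trg C b" "src C a' = trg C b'"
    and eq: "a \<star> b = a' \<star> b'" and deg: "d a = d a'"
  shows "a = a'" "b = b'"
proof -
  have *: "d a + d b = d a' + d b'"
    using ar comp eq by (metis deg_cmp)
  then have "d b = d b'" by (simp add: deg)
  moreover have "\<exists>!p. p \<in> arrows C \<times> arrows C \<and> src C (fst p) = trg C (snd p) \<and>
                 a \<star> b = fst p \<star> snd p \<and> d (fst p) = d a \<and> d (snd p) = d b"
    using ar comp by (intro unique_factorization) (auto intro: cmp_arrows deg_closed deg_cmp)
  ultimately have "(a, b) = (a', b')"
    using ar comp eq deg by (metis (no_types, lifting) fst_conv mem_Sigma_iff snd_conv)
  then show "a = a'" "b = b'" by auto
qed

lemma cancel_right:
  assumes "a \<in> arrows C" "b \<in> arrows C" "c \<in> arrows C" "src C a = trg C c" "src C b = trg C c"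
    and "a \<star> c = b \<star> c"
  shows "a = b"
proof (rule factor_unique)
  have "d a + d c = d b + d c" using assms by (metis deg_cmp)
  then show "d a = d b" by simp
qed (use assms in auto)

text \<open>
  Both \<open>x\<close> and the initial segment of \<open>z\<close> in degree \<open>d x\<close> are initial segments of the same arrow in
  the same degree, hence equal.
\<close>
lemma prefix_of_prefix:
  assumes ar: "x \<in> arrows C" "c \<in> arrows C" "z \<in> arrows C" "w \<in> arrows C"
    and comp: "src C x = trg C c" "src C z = trg C w"
    and eq: "x \<star> c = z \<star> w" and le: "\<And>i. d x i \<le> d z i"
  obtains e where "e \<in> arrows C" "src C x = trg C e" "z = x \<star> e"
proof -
  from factor_exists[OF ar(3) le] obtain x' e where
    x': "x' \<in> arrows C" "e \<in> arrows C" "src C x' = trg C e" "z = x' \<star> e" "d x' = d x" .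
  have "src C e = trg C w" using x' comp by (simp add: src_cmp)
  then have "x' \<star> (e \<star> w) = x \<star> c" "e \<star> w \<in> arrows C" "trg C (e \<star> w) = trg C e"
    using x' ar eq by (auto simp: cmp_assoc cmp_arrows trg_cmp)
  then have "x' = x"
    using x' ar comp by (intro factor_unique(1)[of x' "e \<star> w" x c]) auto
  with x' that show thesis by blast
qed

end


section \<open>Finitely generated right ideals\<close>

lemma right_ideal_iff:
  "right_ideal C R \<longleftrightarrow> R \<subseteq> arrows C \<and>
    (\<forall>r\<in>R. \<forall>c\<in>arrows C. src C r = trg C c \<longrightarrow> r \<star>\<^bsub>C\<^esub> c \<in> R)"
  unfolding right_ideal_def ideal_gen_def by blast

lemma (in arrow_category) subset_ideal_gen:
  assumes "X \<subseteq> arrows C"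
  shows "X \<subseteq> ideal_gen C X"
proof
  fix x assume x: "x \<in> X"
  with assms have "x \<in> arrows C" by blast
  then have "src C x \<in> arrows C" "src C x = trg C (src C x)" "x = x \<star> src C x"
    using src_ids ids_arrows trg_id cmp_src by auto
  with x show "x \<in> ideal_gen C X" unfolding ideal_gen_def by blast
qed

lemma (in arrow_category) right_ideal_ideal_gen:
  assumes "X \<subseteq> arrows C"
  shows "right_ideal C (ideal_gen C X)"
proof -
  have "(x \<star> c) \<star> c' \<in> ideal_gen C X"
    if "x \<in> X" "c \<in> arrows C" "src C x = trg C c" "c' \<in> arrows C" "src C (x \<star> c) = trg C c'" for x c c'
  proof -
    have "src C c = trg C c'" using that assms by (auto simp: src_cmp)
    then have "(x \<star> c) \<star> c' = x \<star> (c \<star> c')" "c \<star> c' \<in> arrows C" "trg C (c \<star> c') = trg C c"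
      using that assms by (auto simp: cmp_assoc cmp_arrows trg_cmp)
    then show ?thesis using that unfolding ideal_gen_def by force
  qed
  then show ?thesis
    using assms unfolding right_ideal_iff by (auto simp: ideal_gen_def cmp_arrows)
qed

context k_graph
begin

text \<open>
  Membership of \<open>y\<close> in \<open>R\<close> is decided by its initial segment in degree \<open>min (d y) (N, \<dots>, N)\<close>.
  For a right ideal this says that \<open>R\<close> is generated by arrows of degree at most \<open>(N, \<dots>, N)\<close>.
  The definition admits all longer initial segments too, which makes it monotone in \<open>N\<close>. Unlike a
  generating set, a bound \<open>N\<close> carries over to intersections and complements without computation.
\<close>
definition settled :: "'a set \<Rightarrow> nat \<Rightarrow> bool" where
  "settled R N \<longleftrightarrow> (\<forall>z\<in>arrows C. \<forall>w\<in>arrows C. src C z = trg C w \<longrightarrow> z \<star> w \<in> R \<longrightarrow>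
    (\<forall>i<k. min (d (z \<star> w) i) N \<le> d z i) \<longrightarrow> z \<in> R)"

lemma settled_mono:
  assumes "settled R M" "M \<le> N"
  shows "settled R N"
  unfolding settled_def
proof (intro ballI impI)
  fix z w
  assume z: "z \<in> arrows C" "w \<in> arrows C" "src C z = trg C w" "z \<star> w \<in> R"
    and "\<forall>i<k. min (d (z \<star> w) i) N \<le> d z i"
  then have "\<forall>i<k. min (d (z \<star> w) i) M \<le> d z i"
    using assms(2) by fastforce
  with z assms(1) show "z \<in> R" unfolding settled_def by blast
qed

lemma deg_zero: "a \<in> arrows C \<Longrightarrow> \<not> i < k \<Longrightarrow> d a i = 0"
  using deg_closed[of a] unfolding degrees_def by auto

lemma finite_degree_bound:
  assumes "finite X" "X \<subseteq> arrows C"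
  shows "\<exists>N. \<forall>x\<in>X. \<forall>i. d x i \<le> N"
proof -
  let ?N = "Max (insert 0 ((\<lambda>(x, i). d x i) ` (X \<times> {..<k})))"
  have "d x i \<le> ?N" if "x \<in> X" for x i
  proof (cases "i < k")
    case True
    then show ?thesis using that assms(1) by (intro Max_ge) auto
  next
    case False
    then show ?thesis using that assms(2) by (simp add: deg_zero subsetD)
  qed
  then show ?thesis by blast
qed

text \<open>
  A bound for the degrees of the generators serves as \<open>N\<close>: a generator that is an initial segment of
  \<open>zw\<close> is short enough to be an initial segment of \<open>z\<close>.
\<close>
lemma fg_settled:
  assumes "fg_right_ideal C R"
  obtains N where "settled R N"
proof -
  from assms obtain X where X: "finite X" "X \<subseteq> arrows C" "R = ideal_gen C X"
    unfolding fg_right_ideal_def by blast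
  then obtain N where N: "\<And>x i. x \<in> X \<Longrightarrow> d x i \<le> N"
    using finite_degree_bound by metis
  have "settled R N"
    unfolding settled_def
  proof (intro ballI impI)
    fix z w
    assume z: "z \<in> arrows C" "w \<in> arrows C" "src C z = trg C w" "z \<star> w \<in> R"
      and deg: "\<forall>i<k. min (d (z \<star> w) i) N \<le> d z i"
    from z X obtain x c where x: "x \<in> X" "c \<in> arrows C" "src C x = trg C c" "x \<star> c = z \<star> w"
      unfolding ideal_gen_def by force
    have xa: "x \<in> arrows C" using x X by blast
    have "d x i \<le> d z i" for i
    proof (cases "i < k")
      case True
      have "d (z \<star> w) = d x + d c" using x xa by (metis deg_cmp)
      with N[OF x(1), of i] have "d x i \<le> min (d (z \<star> w) i) N" by simp
      with deg True show ?thesis by (meson order_trans)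
    qed (simp add: deg_zero xa)
    from prefix_of_prefix[OF xa x(2) z(1,2) x(3) z(3) x(4) this] obtain e where
      "e \<in> arrows C" "src C x = trg C e" "z = x \<star> e" .
    with x(1) show "z \<in> R" unfolding X(3) ideal_gen_def by blast
  qed
  then show thesis by (rule that)
qed

end

text \<open>
  Finitely many identities and row finiteness together mean that there are only finitely many arrows
  of each degree.
\<close>
locale finite_k_graph = k_graph +
  assumes finite_ids: "finite (ids C)"
    and no_src: "no_sources C k d"
    and row_fin: "row_finite C k d"
begin

lemma finite_bounded_degree: "finite {a \<in> arrows C. \<forall>i<k. d a i \<le> N}"
proof -
  let ?D = "{m \<in> degrees k. \<forall>i<k. m i \<le> N}"
  have "inj_on (\<lambda>m. restrict m {..<k}) ?D"
  proof (rule inj_onI)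
    fix m n assume "m \<in> ?D" "n \<in> ?D" and eq: "restrict m {..<k} = restrict n {..<k}"
    then have "m i = n i" for i
      by (cases "i < k") (auto simp: degrees_def dest: fun_cong[of _ _ i])
    then show "m = n" ..
  qed
  moreover have "(\<lambda>m. restrict m {..<k}) ` ?D \<subseteq> {..<k} \<rightarrow>\<^sub>E {..N}"
    by (rule image_subsetI) (simp only: restrict_PiE_iff, simp)
  moreover have "finite ({..<k} \<rightarrow>\<^sub>E {..N})" by (simp add: finite_PiE)
  ultimately have "finite ?D" by (rule inj_on_finite)
  then have "finite (\<Union>e\<in>ids C. \<Union>m\<in>?D. {x \<in> arrows C. trg C x = e \<and> d x = m})"
    using finite_ids row_fin unfolding row_finite_def by auto
  moreover have "{a \<in> arrows C. \<forall>i<k. d a i \<le> N} \<subseteq>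
      (\<Union>e\<in>ids C. \<Union>m\<in>?D. {x \<in> arrows C. trg C x = e \<and> d x = m})"
    using trg_ids deg_closed by auto
  ultimately show ?thesis by (rule rev_finite_subset)
qed

text \<open>
  The elements of degree at most \<open>(N, \<dots>, N)\<close> generate, and there are finitely many of them. This is
  where row finiteness and the finiteness of the set of identities enter.
\<close>
lemma settled_fg:
  assumes R: "right_ideal C R" and N: "settled R N"
  shows "fg_right_ideal C R"
proof -
  let ?X = "R \<inter> {a \<in> arrows C. \<forall>i<k. d a i \<le> N}"
  have "R \<subseteq> ideal_gen C ?X"
  proof
    fix y assume y: "y \<in> R"
    then have ya: "y \<in> arrows C" using R by (auto simp: right_ideal_iff)
    from factor_exists[OF ya, of "\<lambda>i. min (d y i) N"] obtain z w where
      z: "z \<in> arrows C" "w \<in> arrows C" "src C z = trg C w" "y = z \<star> w" "d z = (\<lambda>i. min (d y i) N)"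
      by auto
    then have "z \<in> R" using N y unfolding settled_def by simp
    with z show "y \<in> ideal_gen C ?X" unfolding ideal_gen_def by fastforce
  qed
  moreover have "ideal_gen C ?X \<subseteq> R"
    using R unfolding right_ideal_iff ideal_gen_def by blast
  ultimately have "R = ideal_gen C ?X" by blast
  moreover have "finite ?X" using finite_bounded_degree by blast
  ultimately show ?thesis using R unfolding fg_right_ideal_def by blast
qed

lemma fg_iff_settled: "fg_right_ideal C R \<longleftrightarrow> right_ideal C R \<and> (\<exists>N. settled R N)"
proof
  assume R: "fg_right_ideal C R"
  then have "right_ideal C R" by (simp add: fg_right_ideal_def)
  moreover from R obtain N where "settled R N" by (rule fg_settled)
  ultimately show "right_ideal C R \<and> (\<exists>N. settled R N)" by blast
qed (elim conjE exE, rule settled_fg)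

lemma fg_empty: "fg_right_ideal C {}"
proof (rule settled_fg)
  show "settled {} 0" by (simp add: settled_def)
qed (simp add: right_ideal_iff)

lemma fg_arrows: "fg_right_ideal C (arrows C)"
proof (rule settled_fg)
  show "settled (arrows C) 0" unfolding settled_def by blast
qed (simp add: right_ideal_iff cmp_arrows)

lemma fg_Un: "fg_right_ideal C R \<Longrightarrow> fg_right_ideal C R' \<Longrightarrow> fg_right_ideal C (R \<union> R')"
proof -
  assume *: "fg_right_ideal C R" "fg_right_ideal C R'"
  then obtain M N where "settled R M" "settled R' N" by (auto simp: fg_iff_settled)
  then have "settled R (max M N)" "settled R' (max M N)" by (auto elim: settled_mono)
  then have "settled (R \<union> R') (max M N)" unfolding settled_def by blast
  with * show ?thesis by (auto simp: fg_iff_settled right_ideal_iff)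
qed

lemma fg_Int: "fg_right_ideal C R \<Longrightarrow> fg_right_ideal C R' \<Longrightarrow> fg_right_ideal C (R \<inter> R')"
proof -
  assume *: "fg_right_ideal C R" "fg_right_ideal C R'"
  then obtain M N where "settled R M" "settled R' N" by (auto simp: fg_iff_settled)
  then have "settled R (max M N)" "settled R' (max M N)" by (auto elim: settled_mono)
  then have "settled (R \<inter> R') (max M N)" unfolding settled_def by blast
  with * show ?thesis by (auto simp: fg_iff_settled right_ideal_iff)
qed

definition tail :: "nat \<Rightarrow> 'a set" where
  "tail N = {a \<in> arrows C. \<forall>i<k. N \<le> d a i}"

lemma tail_arrows: "tail N \<subseteq> arrows C"
  unfolding tail_def by blast

lemma tail_antimono: "M \<le> N \<Longrightarrow> tail N \<subseteq> tail M"
  unfolding tail_def by (blast intro: order_trans)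

lemma tail_cmp: "\<lbrakk>a \<in> tail N; c \<in> arrows C; src C a = trg C c\<rbrakk> \<Longrightarrow> a \<star> c \<in> tail N"
  unfolding tail_def by (simp add: cmp_arrows deg_cmp trans_le_add1)

lemma cmp_tail: "\<lbrakk>a \<in> arrows C; c \<in> tail N; src C a = trg C c\<rbrakk> \<Longrightarrow> a \<star> c \<in> tail N"
  unfolding tail_def by (simp add: cmp_arrows deg_cmp trans_le_add2)

lemma settled_tail_cancel:
  assumes "settled R N" "a \<in> tail N" "c \<in> arrows C" "src C a = trg C c" "a \<star> c \<in> R"
  shows "a \<in> R"
proof -
  have "a \<in> arrows C" "\<forall>i<k. min (d (a \<star> c) i) N \<le> d a i"
    using assms(2) unfolding tail_def by (auto simp: min.coboundedI2)
  then show ?thesis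
    using assms unfolding settled_def by blast
qed

text \<open>Long extensions of every arrow are what the absence of sources provides.\<close>
lemma extend_into_tail:
  assumes "a \<in> arrows C"
  obtains c where "c \<in> arrows C" "src C a = trg C c" "a \<star> c \<in> tail N"
proof -
  have "(\<lambda>i. if i < k then N else 0) \<in> degrees k" by (simp add: degrees_def)
  with assms no_src src_ids obtain c where
    "c \<in> arrows C" "trg C c = src C a" "d c = (\<lambda>i. if i < k then N else 0)"
    unfolding no_sources_def by metis
  moreover from this have "c \<in> tail N" by (simp add: tail_def)
  ultimately show thesis using that assms cmp_tail by metis
qed

text \<open>
  The complement of \<open>R\<close> in the long arrows is a right ideal because an arrow of \<open>tail N\<close> with an
  extension in \<open>R\<close> is already in \<open>R\<close>.
\<close>
lemma fg_complement:
  assumes R: "fg_right_ideal C R" and N: "settled R N"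
  shows "fg_right_ideal C (tail N - R)"
proof -
  have "right_ideal C (tail N - R)"
    unfolding right_ideal_iff
    using settled_tail_cancel[OF N] tail_cmp tail_arrows by blast
  moreover have "settled (tail N - R) N"
    unfolding settled_def
  proof (intro ballI impI)
    fix z w
    assume z: "z \<in> arrows C" "w \<in> arrows C" "src C z = trg C w" and zw: "z \<star> w \<in> tail N - R"
      and deg: "\<forall>i<k. min (d (z \<star> w) i) N \<le> d z i"
    have "N \<le> d z i" if "i < k" for i
    proof -
      have "N \<le> d (z \<star> w) i" using zw that unfolding tail_def by blast
      moreover have "min (d (z \<star> w) i) N \<le> d z i" using deg that by blast
      ultimately show ?thesis by simp
    qed
    then have "z \<in> tail N" using z unfolding tail_def by blast
    moreover have "z \<notin> R"
      using z zw R unfolding fg_right_ideal_def right_ideal_iff by blast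
    ultimately show "z \<in> tail N - R" by blast
  qed
  ultimately show ?thesis unfolding fg_iff_settled by blast
qed

lemma fg_tail: "fg_right_ideal C (tail N)"
proof -
  have "settled {} N" by (simp add: settled_def)
  with fg_empty have "fg_right_ideal C (tail N - {})" by (rule fg_complement)
  then show ?thesis by simp
qed

end


section \<open>The inverse monoid of bijective morphisms\<close>

context arrow_category
begin

text \<open>
  Together with injectivity and a finitely generated domain this characterizes membership in \<open>R(C)\<close>;
  the pointwise form passes through converses, composites and unions without naming their domains.
\<close>
definition equivariant :: "('a \<rightharpoonup> 'a) \<Rightarrow> bool" where
  "equivariant \<theta> \<longleftrightarrow> (\<forall>r s. \<theta> r = Some s \<longrightarrow> r \<in> arrows C \<and> s \<in> arrows C \<and> src C s = src C r \<and>
    (\<forall>c\<in>arrows C. src C r = trg C c \<longrightarrow> \<theta> (r \<star> c) = Some (s \<star> c)))"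

lemma equivariantD:
  assumes "equivariant \<theta>" "\<theta> r = Some s"
  shows "r \<in> arrows C" "s \<in> arrows C" "src C s = src C r"
    and "\<lbrakk>c \<in> arrows C; src C r = trg C c\<rbrakk> \<Longrightarrow> \<theta> (r \<star> c) = Some (s \<star> c)"
  using assms unfolding equivariant_def by blast+

lemma mem_ideal_gen_self: "a \<in> arrows C \<Longrightarrow> a \<in> ideal_gen C {a}"
  using subset_ideal_gen[of "{a}"] by blast

lemma fg_ideal_gen: "finite X \<Longrightarrow> X \<subseteq> arrows C \<Longrightarrow> fg_right_ideal C (ideal_gen C X)"
  unfolding fg_right_ideal_def using right_ideal_ideal_gen by blast

text \<open>The image of an ideal is generated by the images of its generators.\<close>
lemma fg_ran:
  assumes "fg_right_ideal C (dom \<theta>)" and \<theta>: "equivariant \<theta>"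
  shows "fg_right_ideal C (ran \<theta>)"
proof -
  from assms obtain X where X: "finite X" "X \<subseteq> arrows C" "dom \<theta> = ideal_gen C X"
    unfolding fg_right_ideal_def by blast
  let ?Y = "(\<lambda>x. the (\<theta> x)) ` X"
  have \<theta>X: "\<theta> x = Some (the (\<theta> x))" if "x \<in> X" for x
  proof -
    have "x \<in> dom \<theta>" using that X subset_ideal_gen by blast
    then show ?thesis by auto
  qed
  have "ran \<theta> = ideal_gen C ?Y"
  proof
    show "ran \<theta> \<subseteq> ideal_gen C ?Y"
    proof
      fix y assume "y \<in> ran \<theta>"
      then obtain r where r: "\<theta> r = Some y" unfolding ran_def by blast
      then have "r \<in> ideal_gen C X" using X by blast
      then obtain x c where x: "x \<in> X" "c \<in> arrows C" "src C x = trg C c" "r = x \<star> c"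
        unfolding ideal_gen_def by blast
      with equivariantD[OF \<theta> \<theta>X[OF x(1)]] r
      have "y = the (\<theta> x) \<star> c" "src C (the (\<theta> x)) = trg C c" by auto
      with x show "y \<in> ideal_gen C ?Y" unfolding ideal_gen_def by blast
    qed
    show "ideal_gen C ?Y \<subseteq> ran \<theta>"
    proof
      fix y assume "y \<in> ideal_gen C ?Y"
      then obtain x c where x: "x \<in> X" "c \<in> arrows C" "src C (the (\<theta> x)) = trg C c"
        "y = the (\<theta> x) \<star> c"
        unfolding ideal_gen_def by blast
      with equivariantD[OF \<theta> \<theta>X[OF x(1)]] have "\<theta> (x \<star> c) = Some y" by simp
      then show "y \<in> ran \<theta>" by (rule ranI)
    qed
  qed
  moreover have "?Y \<subseteq> arrows C"
    using equivariantD(2)[OF \<theta> \<theta>X] by blast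
  ultimately show ?thesis using X(1) fg_ideal_gen by simp
qed

lemma R_carrier_iff:
  "\<theta> \<in> carrier (R_monoid C) \<longleftrightarrow> fg_right_ideal C (dom \<theta>) \<and> partial_inj \<theta> \<and> equivariant \<theta>"
proof
  assume "\<theta> \<in> carrier (R_monoid C)"
  then have fg: "fg_right_ideal C (dom \<theta>)" "fg_right_ideal C (ran \<theta>)"
    and \<theta>: "bij_morphism C (dom \<theta>) (ran \<theta>) \<theta>"
    unfolding R_monoid_def bij_morphism_def by auto
  have "dom \<theta> \<subseteq> arrows C" "ran \<theta> \<subseteq> arrows C"
    using fg unfolding fg_right_ideal_def right_ideal_iff by blast+
  moreover have "src C s = src C r \<and>
      (\<forall>c\<in>arrows C. src C r = trg C c \<longrightarrow> \<theta> (r \<star> c) = Some (s \<star> c))" if rs: "\<theta> r = Some s" for r s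
  proof -
    have "r \<in> dom \<theta>" "the (\<theta> r) = s" using rs by auto
    then show ?thesis using \<theta> unfolding bij_morphism_def by metis
  qed
  ultimately have "equivariant \<theta>"
    unfolding equivariant_def by (meson domI ranI subsetD)
  with fg \<theta> show "fg_right_ideal C (dom \<theta>) \<and> partial_inj \<theta> \<and> equivariant \<theta>"
    by (simp add: bij_morphism_def partial_inj_iff_inj_on)
next
  assume *: "fg_right_ideal C (dom \<theta>) \<and> partial_inj \<theta> \<and> equivariant \<theta>"
  then have "bij_morphism C (dom \<theta>) (ran \<theta>) \<theta>"
    unfolding bij_morphism_def partial_inj_iff_inj_on by (auto simp: equivariantD)
  then show "\<theta> \<in> carrier (R_monoid C)"
    using * fg_ran unfolding R_monoid_def by auto
qed

lemma R_carrierD: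
  assumes "s \<in> carrier (R_monoid C)"
  shows "fg_right_ideal C (dom s)" "partial_inj s" "equivariant s"
  using assms by (auto simp: R_carrier_iff)

lemma R_converse_closed:
  assumes "s \<in> carrier (R_monoid C)"
  shows "map_converse s \<in> carrier (R_monoid C)"
  unfolding R_carrier_iff
proof (intro conjI)
  note s = R_carrierD[OF assms]
  show "fg_right_ideal C (dom (map_converse s))"
    using fg_ran[OF s(1,3)] by (simp add: dom_map_converse s(2))
  show "partial_inj (map_converse s)" using s(2) by (rule partial_inj_converse)
  show "equivariant (map_converse s)"
    unfolding equivariant_def map_converse_eq_Some[OF s(2)]
  proof (intro allI impI)
    fix r x assume "s x = Some r"
    from equivariantD[OF s(3) this] show "r \<in> arrows C \<and> x \<in> arrows C \<and> src C x = src C r \<and>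
      (\<forall>c\<in>arrows C. src C r = trg C c \<longrightarrow> s (x \<star> c) = Some (r \<star> c))" by simp
  qed
qed

lemma R_id_closed:
  assumes "fg_right_ideal C J"
  shows "Some |` J \<in> carrier (R_monoid C)"
proof -
  have J: "J \<subseteq> arrows C" "\<And>r c. \<lbrakk>r \<in> J; c \<in> arrows C; src C r = trg C c\<rbrakk> \<Longrightarrow> r \<star> c \<in> J"
    using assms unfolding fg_right_ideal_def right_ideal_iff by blast+
  have Some_iff: "(Some |` J) r = Some s \<longleftrightarrow> r \<in> J \<and> s = r" for r s
    by (auto simp: restrict_map_def)
  have "dom (Some |` J) = J" by (auto simp: Some_iff dom_def)
  moreover have "partial_inj (Some |` J)"
    unfolding partial_inj_def Some_iff by blast
  moreover have "equivariant (Some |` J)"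
    unfolding equivariant_def Some_iff using J by blast
  ultimately show ?thesis using assms by (simp add: R_carrier_iff)
qed

end

lemma R_mult [simp]: "s \<otimes>\<^bsub>R_monoid C\<^esub> t = s \<circ>\<^sub>m t"
  by (simp add: R_monoid_def)

lemma R_one: "\<one>\<^bsub>R_monoid C\<^esub> = Some |` arrows C"
  by (simp add: R_monoid_def)

context finite_k_graph
begin

lemma R_restrict_closed:
  assumes "s \<in> carrier (R_monoid C)" and J: "fg_right_ideal C J"
  shows "s |` J \<in> carrier (R_monoid C)"
  unfolding R_carrier_iff
proof (intro conjI)
  note s = R_carrierD[OF assms(1)]
  show "fg_right_ideal C (dom (s |` J))" using fg_Int[OF s(1) J] by simp
  show "partial_inj (s |` J)" using s(2) by (rule partial_inj_restrict)
  have "r \<star> c \<in> J" if "r \<in> J" "c \<in> arrows C" "src C r = trg C c" for r c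
    using J that unfolding fg_right_ideal_def right_ideal_iff by blast
  moreover have "(s |` J) r = Some y \<longleftrightarrow> r \<in> J \<and> s r = Some y" for r y
    by (auto simp: restrict_map_def)
  ultimately show "equivariant (s |` J)"
    using equivariantD[OF s(3)] unfolding equivariant_def by metis
qed

lemma R_comp_closed:
  assumes "s \<in> carrier (R_monoid C)" "t \<in> carrier (R_monoid C)"
  shows "s \<circ>\<^sub>m t \<in> carrier (R_monoid C)"
  unfolding R_carrier_iff
proof (intro conjI)
  note s = R_carrierD[OF assms(1)] and t = R_carrierD[OF assms(2)]
  \<comment> \<open>The domain of the composite is an image of the ideal \<open>ran t \<inter> dom s\<close>.\<close>
  have "dom (s \<circ>\<^sub>m t) = ran (map_converse t |` dom s)"
    unfolding dom_def ran_def restrict_map_def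
    by (auto simp: map_comp_Some_iff map_converse_eq_Some[OF t(2)])
  moreover have "map_converse t |` dom s \<in> carrier (R_monoid C)"
    by (intro R_restrict_closed R_converse_closed assms s)
  ultimately show "fg_right_ideal C (dom (s \<circ>\<^sub>m t))"
    using fg_ran R_carrierD by metis
  show "partial_inj (s \<circ>\<^sub>m t)" using s(2) t(2) by (rule partial_inj_comp)
  show "equivariant (s \<circ>\<^sub>m t)"
    unfolding equivariant_def map_comp_Some_iff
  proof (intro allI impI)
    fix r v assume "\<exists>u. t r = Some u \<and> s u = Some v"
    then obtain u where u: "t r = Some u" "s u = Some v" by blast
    show "r \<in> arrows C \<and> v \<in> arrows C \<and> src C v = src C r \<and>
      (\<forall>c\<in>arrows C. src C r = trg C c \<longrightarrow> (\<exists>w. t (r \<star> c) = Some w \<and> s w = Some (v \<star> c)))"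
      using equivariantD[OF t(3) u(1)] equivariantD[OF s(3) u(2)] by simp
  qed
qed

lemma R_empty_closed: "Map.empty \<in> carrier (R_monoid C)"
  using R_id_closed[OF fg_empty] by simp

lemma R_restrict_arrows:
  assumes "s \<in> carrier (R_monoid C)"
  shows "s |` arrows C = s"
proof
  fix x
  show "(s |` arrows C) x = s x"
    using equivariantD(1)[OF R_carrierD(3)[OF assms], of x]
    by (cases "s x") (auto simp: restrict_map_def)
qed

lemma monoid_R: "monoid (R_monoid C)"
proof (rule monoidI)
  fix s assume s: "s \<in> carrier (R_monoid C)"
  have "((Some |` arrows C) \<circ>\<^sub>m s) x = s x" for x
    using equivariantD(2)[OF R_carrierD(3)[OF s], of x]
    by (cases "s x") (auto simp: map_comp_def)
  then show "\<one>\<^bsub>R_monoid C\<^esub> \<otimes>\<^bsub>R_monoid C\<^esub> s = s" by (auto simp: R_one)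
  show "s \<otimes>\<^bsub>R_monoid C\<^esub> \<one>\<^bsub>R_monoid C\<^esub> = s"
    using s by (simp add: R_one comp_restrict_Some R_restrict_arrows)
qed (simp_all add: R_comp_closed R_one R_id_closed fg_arrows map_comp_assoc)

lemma R_is_sinv_iff:
  assumes "s \<in> carrier (R_monoid C)"
  shows "is_sinv (R_monoid C) s t \<longleftrightarrow> t = map_converse s"
  unfolding is_sinv_def R_mult
  using assms R_converse_closed partial_inj_generalized_inverse R_carrierD(2) by metis

lemma R_sinv: "s \<in> carrier (R_monoid C) \<Longrightarrow> sinv (R_monoid C) s = map_converse s"
  unfolding sinv_def by (rule the_equality) (simp_all add: R_is_sinv_iff)

lemma R_nat_le_iff:
  assumes "s \<in> carrier (R_monoid C)" "t \<in> carrier (R_monoid C)"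
  shows "nat_le (R_monoid C) s t \<longleftrightarrow> s \<subseteq>\<^sub>m t"
proof -
  have "nat_le (R_monoid C) s t \<longleftrightarrow> s = t |` dom s"
    unfolding nat_le_def
    using R_carrierD(2)[OF assms(1)]
    by (simp only: R_mult map_comp_assoc R_sinv[OF assms(1)] converse_comp_self comp_restrict_Some)
  also have "\<dots> \<longleftrightarrow> s \<subseteq>\<^sub>m t"
    unfolding map_le_def fun_eq_iff restrict_map_def by (metis domIff)
  finally show ?thesis .
qed

lemma R_is_zero_iff: "is_zero (R_monoid C) z \<longleftrightarrow> z = Map.empty"
proof
  assume z: "is_zero (R_monoid C) z"
  then have "Map.empty \<circ>\<^sub>m z = z"
    unfolding is_zero_def using R_empty_closed by auto
  then show "z = Map.empty" by simp
qed (simp add: is_zero_def R_empty_closed)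

lemma R_idems_iff: "e \<in> idems (R_monoid C) \<longleftrightarrow> (\<exists>J. fg_right_ideal C J \<and> e = Some |` J)"
proof
  assume "e \<in> idems (R_monoid C)"
  then have e: "e \<in> carrier (R_monoid C)" "e \<circ>\<^sub>m e = e" by (auto simp: idems_def)
  have "e x = Some x" if "e x = Some y" for x y
  proof -
    have "(e \<circ>\<^sub>m e) x = Some y" using e(2) that by simp
    then have "e y = Some y" using that by simp
    with that show ?thesis using partial_injD[OF R_carrierD(2)[OF e(1)]] by metis
  qed
  then have "e x = (Some |` dom e) x" for x
    by (cases "e x") (auto simp: restrict_map_def)
  then show "\<exists>J. fg_right_ideal C J \<and> e = Some |` J"
    using R_carrierD(1)[OF e(1)] by blast
next
  assume "\<exists>J. fg_right_ideal C J \<and> e = Some |` J"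
  then show "e \<in> idems (R_monoid C)"
    by (auto simp: idems_def R_id_closed comp_restrict_Some)
qed

end


section \<open>Long arrows\<close>

context finite_k_graph
begin

text \<open>
  Only the diagonal degrees \<open>(N, \<dots>, N)\<close> are used; they are cofinal in \<open>\<nat>\<^sup>k\<close>, so this is the filter
  of all sets that contain every arrow beyond some degree.
\<close>
definition far :: "'a filter" where
  "far = (INF N. principal (tail N))"

lemma eventually_far: "eventually P far \<longleftrightarrow> (\<exists>N. \<forall>a\<in>tail N. P a)"
proof -
  have "\<exists>x\<in>UNIV. principal (tail x) \<le> inf (principal (tail M)) (principal (tail N))" for M N
    using tail_antimono[of M "max M N"] tail_antimono[of N "max M N"]
    by (intro bexI[of _ "max M N"]) auto
  then show ?thesis
    unfolding far_def by (subst eventually_INF_base) (auto simp: eventually_principal)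
qed

lemma eventually_far_tail: "\<forall>\<^sub>F a in far. a \<in> tail N"
  unfolding eventually_far by blast

lemma eventually_far_arrows: "\<forall>\<^sub>F a in far. a \<in> arrows C"
  unfolding eventually_far using tail_arrows by blast

lemma eventually_far_extend:
  assumes "eventually P far" "a \<in> arrows C"
  obtains c where "c \<in> arrows C" "src C a = trg C c" "P (a \<star> c)"
  using assms extend_into_tail unfolding eventually_far by metis

lemma eventually_far_cancel:
  assumes "fg_right_ideal C J"
  shows "\<forall>\<^sub>F a in far. \<forall>c\<in>arrows C. src C a = trg C c \<longrightarrow> a \<star> c \<in> J \<longrightarrow> a \<in> J"
proof -
  from assms obtain N where "settled J N" by (rule fg_settled)
  then show ?thesis unfolding eventually_far using settled_tail_cancel by blast
qed

text \<open>
  On \<open>x0 c\<close>, with \<open>x0\<close> a generator of the domain, the value is \<open>s(x0) c\<close>. The generators have bounded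
  degree, so the remaining factor \<open>c\<close> of a long argument is long, and with it the value.
\<close>
lemma eventually_far_image:
  assumes "s \<in> carrier (R_monoid C)" "eventually P far"
  shows "\<forall>\<^sub>F x in far. \<forall>y. s x = Some y \<longrightarrow> P y"
proof -
  note s = R_carrierD[OF assms(1)]
  from s(1) obtain X where X: "finite X" "X \<subseteq> arrows C" "dom s = ideal_gen C X"
    unfolding fg_right_ideal_def by blast
  then obtain M where M: "\<And>x i. x \<in> X \<Longrightarrow> d x i \<le> M"
    using finite_degree_bound by metis
  from assms(2) obtain N where N: "\<And>a. a \<in> tail N \<Longrightarrow> P a"
    unfolding eventually_far by blast
  have "P y" if x: "x \<in> tail (M + N)" and y: "s x = Some y" for x y
  proof -
    from y X(3) have "x \<in> ideal_gen C X" by blast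
    then obtain x0 c where c: "x0 \<in> X" "c \<in> arrows C" "src C x0 = trg C c" "x = x0 \<star> c"
      unfolding ideal_gen_def by blast
    have x0: "x0 \<in> arrows C" using c X by blast
    have "x0 \<in> dom s" using c(1) X subset_ideal_gen by blast
    then obtain y0 where y0: "s x0 = Some y0" by blast
    note s0 = equivariantD[OF s(3) y0]
    have "N \<le> d c i" if "i < k" for i
    proof -
      have "M + N \<le> d x0 i + d c i"
        using x that c x0 by (simp add: tail_def deg_cmp)
      with M[OF c(1), of i] show ?thesis by linarith
    qed
    then have "c \<in> tail N" using c by (simp add: tail_def)
    then have "y0 \<star> c \<in> tail N" using s0 c by (intro cmp_tail) auto
    moreover have "y = y0 \<star> c" using s0(4)[OF c(2,3)] y c(4) by simp
    ultimately show "P y" using N by simp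
  qed
  then show ?thesis unfolding eventually_far by blast
qed

lemma eventually_far_preimage:
  assumes "s \<in> carrier (R_monoid C)" "eventually P far"
  shows "\<forall>\<^sub>F y in far. \<forall>x. s x = Some y \<longrightarrow> P x"
  using eventually_far_image[OF R_converse_closed[OF assms(1)] assms(2)]
  by (simp add: map_converse_eq_Some R_carrierD(2)[OF assms(1)])

text \<open>
  From left to right, the hypothesis is applied to the restriction of \<open>s\<close> to the principal ideal of a
  long arrow \<open>a\<close>; from right to left, the required common lower bound is the restriction of the given
  element to long arrows, which is not empty because there are no sources.
\<close>
lemma R_meets_all_below_iff:
  assumes "s \<in> carrier (R_monoid C)" "t \<in> carrier (R_monoid C)"
  shows "meets_all_below (R_monoid C) s t \<longleftrightarrow> (\<forall>\<^sub>F a in far. a \<in> dom s \<longrightarrow> s a = t a)"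
proof
  assume meets: "meets_all_below (R_monoid C) s t"
  note s = R_carrierD[OF assms(1)] and t = R_carrierD[OF assms(2)]
  from eventually_far_cancel[OF t(1)]
  show "\<forall>\<^sub>F a in far. a \<in> dom s \<longrightarrow> s a = t a"
  proof (rule eventually_mono, intro impI)
    fix a
    assume cancel: "\<forall>c\<in>arrows C. src C a = trg C c \<longrightarrow> a \<star> c \<in> dom t \<longrightarrow> a \<in> dom t"
      and "a \<in> dom s"
    then obtain u where u: "s a = Some u" by blast
    note su = equivariantD[OF s(3) u]
    let ?x = "s |` ideal_gen C {a}"
    have x: "?x \<in> carrier (R_monoid C)"
      using assms(1) su(1) by (intro R_restrict_closed fg_ideal_gen) auto
    moreover have "?x a = Some u"
      using u mem_ideal_gen_self[OF su(1)] by simp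
    then have "?x \<noteq> Map.empty" by (metis option.distinct(1))
    moreover have "?x \<subseteq>\<^sub>m s" by (simp add: map_le_def)
    ultimately obtain z where z: "z \<in> carrier (R_monoid C)" "z \<noteq> Map.empty"
      "z \<subseteq>\<^sub>m ?x" "z \<subseteq>\<^sub>m t"
      using meets assms R_nat_le_iff unfolding meets_all_below_def R_is_zero_iff by metis
    then obtain b y where b: "z b = Some y" by (metis option.exhaust ext)
    then have "?x b = Some y" "t b = Some y"
      using z(3,4) by (metis domI map_le_def)+
    then have bs: "b \<in> ideal_gen C {a}" "s b = Some y" "t b = Some y"
      by (auto simp: restrict_map_def split: if_splits)
    then obtain c where c: "c \<in> arrows C" "src C a = trg C c" "b = a \<star> c"
      unfolding ideal_gen_def by blast
    with cancel bs(3) obtain v where v: "t a = Some v" by blast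
    note tv = equivariantD[OF t(3) v]
    have "u \<star> c = v \<star> c"
      using su(4)[OF c(1,2)] tv(4)[OF c(1,2)] bs c(3) by simp
    then have "u = v" using su tv c by (intro cancel_right[of u v c]) auto
    with u v show "s a = t a" by simp
  qed
next
  assume "\<forall>\<^sub>F a in far. a \<in> dom s \<longrightarrow> s a = t a"
  then obtain N where N: "\<And>a. a \<in> tail N \<Longrightarrow> a \<in> dom s \<Longrightarrow> s a = t a"
    unfolding eventually_far by blast
  show "meets_all_below (R_monoid C) s t"
    unfolding meets_all_below_def R_is_zero_iff
  proof (intro ballI impI, elim conjE)
    fix x assume x: "x \<in> carrier (R_monoid C)" "x \<noteq> Map.empty" "nat_le (R_monoid C) x s"
    then have xs: "x \<subseteq>\<^sub>m s" using assms by (simp add: R_nat_le_iff)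
    from x(2) obtain b y where b: "x b = Some y" by (metis option.exhaust ext)
    note xb = equivariantD[OF R_carrierD(3)[OF x(1)] b]
    obtain c where "c \<in> arrows C" "src C b = trg C c" "b \<star> c \<in> tail N"
      using extend_into_tail[OF xb(1)] .
    then have "(x |` tail N) (b \<star> c) = Some (y \<star> c)" using xb(4) by simp
    then have "x |` tail N \<noteq> Map.empty" by (metis option.distinct(1))
    moreover have "x |` tail N \<in> carrier (R_monoid C)"
      using x(1) fg_tail by (rule R_restrict_closed)
    moreover have "x |` tail N \<subseteq>\<^sub>m x" by (simp add: map_le_def)
    moreover have "x |` tail N \<subseteq>\<^sub>m t"
      unfolding map_le_def
    proof
      fix a assume "a \<in> dom (x |` tail N)"
      then have a: "a \<in> tail N" "a \<in> dom x" by auto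
      with xs have "x a = s a" "a \<in> dom s" by (auto simp: map_le_def) (metis domI)
      with a N show "(x |` tail N) a = t a" by simp
    qed
    ultimately show "\<exists>z\<in>carrier (R_monoid C). z \<noteq> Map.empty \<and> nat_le (R_monoid C) z x \<and>
        nat_le (R_monoid C) z t"
      using x assms by (intro bexI[of _ "x |` tail N"]) (auto simp: R_nat_le_iff)
  qed
qed

lemma lenz_cong_iff:
  "(s, t) \<in> lenz_cong (R_monoid C) \<longleftrightarrow>
    s \<in> carrier (R_monoid C) \<and> t \<in> carrier (R_monoid C) \<and> (\<forall>\<^sub>F a in far. s a = t a)"
proof (cases "s \<in> carrier (R_monoid C) \<and> t \<in> carrier (R_monoid C)")
  case True
  have "(\<forall>\<^sub>F a in far. a \<in> dom s \<longrightarrow> s a = t a) \<and> (\<forall>\<^sub>F a in far. a \<in> dom t \<longrightarrow> t a = s a)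
      \<longleftrightarrow> (\<forall>\<^sub>F a in far. s a = t a)"
    unfolding eventually_conj_iff[symmetric]
    by (rule eventually_cong[OF always_eventually]) (auto simp: dom_def)
  with True show ?thesis
    unfolding lenz_cong_def by (simp add: R_meets_all_below_iff)
qed (auto simp: lenz_cong_def)

text \<open>
  An essential ideal meets the principal ideal of every long arrow \<open>a\<close>, and a long arrow with an
  extension in a finitely generated ideal belongs to it. Conversely, any element of a nonempty ideal
  has an extension in \<open>J\<close>. An essential idempotent must moreover be nonzero, so there has to be an
  arrow at all; hence the assumption on the identities.
\<close>
lemma R_essential_iff:
  assumes J: "fg_right_ideal C J" and ne: "ids C \<noteq> {}"
  shows "essential (R_monoid C) (Some |` J) \<longleftrightarrow> (\<forall>\<^sub>F a in far. a \<in> J)"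
proof
  assume ess: "essential (R_monoid C) (Some |` J)"
  from eventually_far_cancel[OF J] eventually_far_arrows
  show "\<forall>\<^sub>F a in far. a \<in> J"
  proof eventually_elim
    case (elim a)
    have "Some |` ideal_gen C {a} \<in> idems (R_monoid C)"
      unfolding R_idems_iff using elim(2) fg_ideal_gen[of "{a}"] by auto
    moreover have "Some |` ideal_gen C {a} \<noteq> Map.empty"
      using mem_ideal_gen_self[OF elim(2)] by (metis option.distinct(1) restrict_in)
    ultimately have "(Some |` J) \<circ>\<^sub>m (Some |` ideal_gen C {a}) \<noteq> Map.empty"
      using ess unfolding essential_def R_is_zero_iff by simp
    then have "J \<inter> ideal_gen C {a} \<noteq> {}" by (auto simp: comp_restrict_Some)
    then obtain b where "b \<in> J" "b \<in> ideal_gen C {a}" by blast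
    with elim(1) show "a \<in> J" unfolding ideal_gen_def by blast
  qed
next
  assume ev: "\<forall>\<^sub>F a in far. a \<in> J"
  have J_meets: "J \<inter> J' \<noteq> {}" if J': "fg_right_ideal C J'" "J' \<noteq> {}" for J'
  proof -
    from J' obtain b where b: "b \<in> J'" "b \<in> arrows C"
      unfolding fg_right_ideal_def right_ideal_iff by blast
    from ev b(2) obtain c where "c \<in> arrows C" "src C b = trg C c" "b \<star> c \<in> J"
      by (rule eventually_far_extend)
    moreover from this b(1) J'(1) have "b \<star> c \<in> J'"
      unfolding fg_right_ideal_def right_ideal_iff by blast
    ultimately show ?thesis by blast
  qed
  have nonzero: "Some |` J' \<noteq> Map.empty \<longleftrightarrow> J' \<noteq> {}" for J' :: "'a set"
    by (auto simp: fun_eq_iff restrict_map_def split: if_splits)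
  have "J \<noteq> {}" using J_meets[OF fg_arrows] ne ids_arrows by blast
  moreover have "\<not> is_zero (R_monoid C) (Some |` J \<otimes>\<^bsub>R_monoid C\<^esub> f)"
    if "f \<in> idems (R_monoid C)" "\<not> is_zero (R_monoid C) f" for f
  proof -
    from that obtain J' where "fg_right_ideal C J'" "f = Some |` J'" "J' \<noteq> {}"
      unfolding R_idems_iff R_is_zero_iff by (auto simp: nonzero)
    with J_meets[of J'] show ?thesis
      unfolding R_is_zero_iff by (simp add: comp_restrict_Some nonzero Int_commute)
  qed
  ultimately show "essential (R_monoid C) (Some |` J)"
    unfolding essential_def R_is_zero_iff using J by (auto simp: R_idems_iff nonzero R_is_zero_iff)
qed

end


section \<open>The quotient by the Lenz congruence\<close>

context finite_k_graph
begin

lemma equiv_lenz_cong: "equiv (carrier (R_monoid C)) (lenz_cong (R_monoid C))"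
proof (rule equivI)
  show "lenz_cong (R_monoid C) \<subseteq> carrier (R_monoid C) \<times> carrier (R_monoid C)"
    by (auto simp: lenz_cong_def)
  show "refl_on (carrier (R_monoid C)) (lenz_cong (R_monoid C))"
    by (rule refl_onI) (simp add: lenz_cong_iff)
  show "sym (lenz_cong (R_monoid C))"
    by (rule symI) (simp add: lenz_cong_iff eq_commute)
  show "trans (lenz_cong (R_monoid C))"
  proof (rule transI)
    fix s t u assume "(s, t) \<in> lenz_cong (R_monoid C)" "(t, u) \<in> lenz_cong (R_monoid C)"
    then show "(s, u) \<in> lenz_cong (R_monoid C)"
      unfolding lenz_cong_iff by (auto elim: eventually_elim2)
  qed
qed

text \<open>
  For \<open>s\<close> and \<open>s'\<close> to agree at \<open>t a\<close> it is needed that \<open>t\<close> sends long arrows to long arrows.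
\<close>
lemma lenz_cong_mult:
  assumes "(s, s') \<in> lenz_cong (R_monoid C)" "(t, t') \<in> lenz_cong (R_monoid C)"
  shows "(s \<otimes>\<^bsub>R_monoid C\<^esub> t, s' \<otimes>\<^bsub>R_monoid C\<^esub> t') \<in> lenz_cong (R_monoid C)"
proof -
  from assms have ev: "\<forall>\<^sub>F a in far. s a = s' a" "\<forall>\<^sub>F a in far. t a = t' a"
    and carr: "s \<in> carrier (R_monoid C)" "s' \<in> carrier (R_monoid C)"
      "t \<in> carrier (R_monoid C)" "t' \<in> carrier (R_monoid C)"
    unfolding lenz_cong_iff by auto
  from eventually_far_image[OF carr(3) ev(1)] ev(2)
  have "\<forall>\<^sub>F a in far. (s \<circ>\<^sub>m t) a = (s' \<circ>\<^sub>m t') a"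
    by eventually_elim (auto simp: map_comp_def split: option.splits)
  with carr show ?thesis by (simp add: lenz_cong_iff R_comp_closed)
qed

definition germ :: "('a \<rightharpoonup> 'a) \<Rightarrow> ('a \<rightharpoonup> 'a) set" where
  "germ s = lenz_cong (R_monoid C) `` {s}"

lemma germ_eq_iff:
  assumes "s \<in> carrier (R_monoid C)" "t \<in> carrier (R_monoid C)"
  shows "germ s = germ t \<longleftrightarrow> (\<forall>\<^sub>F a in far. s a = t a)"
  unfolding germ_def eq_equiv_class_iff[OF equiv_lenz_cong assms]
  using assms by (simp add: lenz_cong_iff)

lemma B_carrier: "carrier (B_monoid C) = germ ` carrier (R_monoid C)"
  by (auto simp: B_monoid_def quotient_monoid_def quotient_def germ_def)

lemma germ_closed: "s \<in> carrier (R_monoid C) \<Longrightarrow> germ s \<in> carrier (B_monoid C)"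
  by (simp add: B_carrier)

lemma B_one: "\<one>\<^bsub>B_monoid C\<^esub> = germ (Some |` arrows C)"
  by (simp add: B_monoid_def quotient_monoid_def germ_def R_one)

lemma B_mult:
  assumes "s \<in> carrier (R_monoid C)" "t \<in> carrier (R_monoid C)"
  shows "germ s \<otimes>\<^bsub>B_monoid C\<^esub> germ t = germ (s \<circ>\<^sub>m t)"
  unfolding B_monoid_def germ_def
  using quotient_monoid_mult[OF equiv_lenz_cong lenz_cong_mult assms] by simp

lemma monoid_B: "monoid (B_monoid C)"
  unfolding B_monoid_def
  using quotient_monoid_monoid[OF monoid_R equiv_lenz_cong lenz_cong_mult] .

text \<open>
  The pointwise argument for partial injections, with one care: where \<open>map_converse s y = Some x\<close>, the
  equation \<open>sts = s\<close> is used at \<open>x\<close>, which is long because \<open>y\<close> is.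
\<close>
lemma B_is_sinv_iff:
  assumes s: "s \<in> carrier (R_monoid C)" and t: "t \<in> carrier (R_monoid C)"
  shows "is_sinv (B_monoid C) (germ s) (germ t) \<longleftrightarrow> germ t = germ (map_converse s)"
proof
  note sinj = R_carrierD(2)[OF s] and tinj = R_carrierD(2)[OF t]
  assume "is_sinv (B_monoid C) (germ s) (germ t)"
  then have "germ (s \<circ>\<^sub>m t \<circ>\<^sub>m s) = germ s" "germ (t \<circ>\<^sub>m s \<circ>\<^sub>m t) = germ t"
    unfolding is_sinv_def using s t by (simp_all add: B_mult R_comp_closed)
  then have sts: "\<forall>\<^sub>F x in far. (s \<circ>\<^sub>m t \<circ>\<^sub>m s) x = s x"
    and tst: "\<forall>\<^sub>F y in far. (t \<circ>\<^sub>m s \<circ>\<^sub>m t) y = t y"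
    using s t by (simp_all add: germ_eq_iff R_comp_closed)
  from tst eventually_far_image[OF R_converse_closed[OF s] sts]
  have "\<forall>\<^sub>F y in far. t y = map_converse s y"
  proof eventually_elim
    case (elim y)
    show "t y = map_converse s y"
    proof (cases "t y")
      case (Some x)
      with elim(1) obtain y' where "s x = Some y'" "t y' = Some x"
        by (auto simp: map_comp_Some_iff)
      then have "s x = Some y" using partial_injD[OF tinj] Some by metis
      then have "map_converse s y = Some x" by (simp add: map_converse_eq_Some[OF sinj])
      then show ?thesis using Some by simp
    next
      case None
      have False if x: "map_converse s y = Some x" for x
      proof -
        have "s x = Some y" using x by (simp add: map_converse_eq_Some[OF sinj])
        moreover have "(s \<circ>\<^sub>m t \<circ>\<^sub>m s) x = s x" using elim(2) x by blast
        ultimately show False using None by (simp add: map_comp_def)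
      qed
      then show ?thesis using None by (cases "map_converse s y") auto
    qed
  qed
  then show "germ t = germ (map_converse s)"
    using s t by (simp add: germ_eq_iff R_converse_closed)
next
  assume eq: "germ t = germ (map_converse s)"
  have "s \<circ>\<^sub>m map_converse s \<circ>\<^sub>m s = s" "map_converse s \<circ>\<^sub>m s \<circ>\<^sub>m map_converse s = map_converse s"
    using partial_inj_generalized_inverse[of s "map_converse s"]
      R_carrierD(2)[OF s] R_carrierD(2)[OF R_converse_closed[OF s]] by blast+
  with s show "is_sinv (B_monoid C) (germ s) (germ t)"
    unfolding is_sinv_def eq
    by (simp add: B_mult R_comp_closed R_converse_closed germ_closed)
qed

lemma B_sinv:
  assumes "s \<in> carrier (R_monoid C)"
  shows "is_sinv (B_monoid C) (germ s) X \<longleftrightarrow> X = germ (map_converse s)"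
    and "sinv (B_monoid C) (germ s) = germ (map_converse s)"
proof -
  show *: "is_sinv (B_monoid C) (germ s) X \<longleftrightarrow> X = germ (map_converse s)" for X
  proof
    assume X: "is_sinv (B_monoid C) (germ s) X"
    then obtain t where t: "t \<in> carrier (R_monoid C)" "X = germ t"
      unfolding is_sinv_def B_carrier by blast
    with X show "X = germ (map_converse s)"
      using B_is_sinv_iff[OF assms t(1)] by simp
  next
    show "is_sinv (B_monoid C) (germ s) X" if "X = germ (map_converse s)"
      using that B_is_sinv_iff[OF assms R_converse_closed[OF assms]] by simp
  qed
  then show "sinv (B_monoid C) (germ s) = germ (map_converse s)"
    unfolding sinv_def by (intro the_equality) (simp_all add: *)
qed

lemma inverse_monoid_zero_B: "inverse_monoid_zero (B_monoid C)"
proof -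
  interpret B: monoid "B_monoid C" by (rule monoid_B)
  show ?thesis
  proof unfold_locales
    fix X assume "X \<in> carrier (B_monoid C)"
    then obtain s where "s \<in> carrier (R_monoid C)" "X = germ s" unfolding B_carrier by blast
    then show "\<exists>!Y. is_sinv (B_monoid C) X Y" by (simp add: B_sinv(1))
  next
    have "is_zero (B_monoid C) (germ Map.empty)"
      unfolding is_zero_def B_carrier using R_empty_closed by (auto simp: B_mult)
    then show "\<exists>Z. is_zero (B_monoid C) Z" ..
  qed
qed

lemma B_nat_le_iff:
  assumes s: "s \<in> carrier (R_monoid C)" and t: "t \<in> carrier (R_monoid C)"
  shows "nat_le (B_monoid C) (germ s) (germ t) \<longleftrightarrow> (\<forall>\<^sub>F x in far. \<forall>y. s x = Some y \<longrightarrow> t x = Some y)"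
proof -
  have "t \<circ>\<^sub>m map_converse s \<circ>\<^sub>m s = t |` dom s"
    unfolding map_comp_assoc using R_carrierD(2)[OF s]
    by (simp add: converse_comp_self comp_restrict_Some)
  then have "germ t \<otimes>\<^bsub>B_monoid C\<^esub> germ (map_converse s) \<otimes>\<^bsub>B_monoid C\<^esub> germ s = germ (t |` dom s)"
    using s t by (simp add: B_mult R_comp_closed R_converse_closed)
  then have "nat_le (B_monoid C) (germ s) (germ t) \<longleftrightarrow> germ s = germ (t |` dom s)"
    unfolding nat_le_def B_sinv(2)[OF s] by simp
  also have "\<dots> \<longleftrightarrow> (\<forall>\<^sub>F x in far. s x = (t |` dom s) x)"
    using s t R_restrict_closed[OF t R_carrierD(1)[OF s]] by (simp add: germ_eq_iff)
  also have "\<dots> \<longleftrightarrow> (\<forall>\<^sub>F x in far. \<forall>y. s x = Some y \<longrightarrow> t x = Some y)"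
    by (rule eventually_cong[OF always_eventually]) (auto simp: restrict_map_def dom_def)
  finally show ?thesis .
qed

lemma B_nat_le_antisym:
  assumes "s \<in> carrier (R_monoid C)" "t \<in> carrier (R_monoid C)"
    and "nat_le (B_monoid C) (germ s) (germ t)" "nat_le (B_monoid C) (germ t) (germ s)"
  shows "germ s = germ t"
proof -
  have "\<forall>\<^sub>F x in far. \<forall>y. s x = Some y \<longrightarrow> t x = Some y"
    "\<forall>\<^sub>F x in far. \<forall>y. t x = Some y \<longrightarrow> s x = Some y"
    using assms by (simp_all add: B_nat_le_iff)
  then have "\<forall>\<^sub>F x in far. s x = t x"
  proof eventually_elim
    case (elim x)
    then show ?case by (cases "s x"; cases "t x") auto
  qed
  with assms(1,2) show ?thesis by (simp add: germ_eq_iff)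
qed

lemma germ_idem_iff:
  assumes s: "s \<in> carrier (R_monoid C)"
  shows "germ s \<in> idems (B_monoid C) \<longleftrightarrow> (\<forall>\<^sub>F x in far. \<forall>y. s x = Some y \<longrightarrow> y = x)"
proof -
  note sinj = R_carrierD(2)[OF s]
  have "(s \<circ>\<^sub>m s) x = s x \<longleftrightarrow> (\<forall>y. s x = Some y \<longrightarrow> y = x)" for x
  proof (cases "s x")
    case (Some y)
    then have "s y = Some y \<longleftrightarrow> y = x" using partial_injD[OF sinj, of y y x] by auto
    with Some show ?thesis by simp
  qed simp
  then show ?thesis
    using s by (simp add: idems_def germ_closed B_mult germ_eq_iff R_comp_closed)
qed

lemma B_idems: "idems (B_monoid C) = (\<lambda>J. germ (Some |` J)) ` {J. fg_right_ideal C J}"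
proof
  show "idems (B_monoid C) \<subseteq> (\<lambda>J. germ (Some |` J)) ` {J. fg_right_ideal C J}"
  proof
    fix X assume X: "X \<in> idems (B_monoid C)"
    then obtain s where s: "s \<in> carrier (R_monoid C)" "X = germ s"
      unfolding idems_def B_carrier by blast
    note fg = R_carrierD(1)[OF s(1)]
    have "\<forall>\<^sub>F x in far. \<forall>y. s x = Some y \<longrightarrow> y = x" using X s germ_idem_iff by simp
    then have "\<forall>\<^sub>F x in far. s x = (Some |` dom s) x"
      by (rule eventually_mono) (auto simp: restrict_map_def dom_def)
    then have "X = germ (Some |` dom s)"
      using s fg by (simp add: germ_eq_iff R_id_closed)
    with fg show "X \<in> (\<lambda>J. germ (Some |` J)) ` {J. fg_right_ideal C J}" by blast
  qed
  show "(\<lambda>J. germ (Some |` J)) ` {J. fg_right_ideal C J} \<subseteq> idems (B_monoid C)"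
  proof clarify
    fix J assume "fg_right_ideal C J"
    then have J: "Some |` J \<in> carrier (R_monoid C)" by (rule R_id_closed)
    show "germ (Some |` J) \<in> idems (B_monoid C)"
      unfolding germ_idem_iff[OF J] by (simp add: restrict_map_def)
  qed
qed

end


section \<open>Joins of compatible germs\<close>

context finite_k_graph
begin

lemma R_union_closed:
  assumes s: "s \<in> carrier (R_monoid C)" and t: "t \<in> carrier (R_monoid C)"
    and agree: "\<And>x y z. \<lbrakk>s x = Some y; t x = Some z\<rbrakk> \<Longrightarrow> y = z"
    and coagree: "\<And>x z y. \<lbrakk>s x = Some y; t z = Some y\<rbrakk> \<Longrightarrow> x = z"
  shows "s ++ t \<in> carrier (R_monoid C)"
    and "(s ++ t) x = Some y \<longleftrightarrow> s x = Some y \<or> t x = Some y"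
proof -
  show union: "(s ++ t) x = Some y \<longleftrightarrow> s x = Some y \<or> t x = Some y" for x y
    using agree[of x] by (cases "t x") (auto simp: map_add_def)
  note s = R_carrierD[OF s] and t = R_carrierD[OF t]
  show "s ++ t \<in> carrier (R_monoid C)"
    unfolding R_carrier_iff
  proof (intro conjI)
    show "fg_right_ideal C (dom (s ++ t))" using fg_Un[OF t(1) s(1)] by simp
    show "partial_inj (s ++ t)"
      unfolding partial_inj_def union
      using partial_injD[OF s(2)] partial_injD[OF t(2)] coagree by blast
    show "equivariant (s ++ t)"
      unfolding equivariant_def union
      using equivariantD[OF s(3)] equivariantD[OF t(3)] by blast
  qed
qed

text \<open>
  Idempotency of \<open>s t\<inverse>\<close> speaks about long values of \<open>t\<close>; it is pulled back along \<open>t\<close> to a statement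
  about long arguments.
\<close>
lemma compatible_germs:
  assumes s: "s \<in> carrier (R_monoid C)" and t: "t \<in> carrier (R_monoid C)"
    and comp: "compatible (B_monoid C) (germ s) (germ t)"
  shows "\<forall>\<^sub>F x in far. \<forall>y z. s x = Some y \<longrightarrow> t x = Some z \<longrightarrow> y = z"
    and "\<forall>\<^sub>F z in far. \<forall>x y. s x = Some y \<longrightarrow> t z = Some y \<longrightarrow> x = z"
proof -
  note sinj = R_carrierD(2)[OF s] and tinj = R_carrierD(2)[OF t]
  from comp s t have idem: "germ (map_converse s \<circ>\<^sub>m t) \<in> idems (B_monoid C)"
    "germ (s \<circ>\<^sub>m map_converse t) \<in> idems (B_monoid C)"
    by (simp_all add: compatible_def B_sinv(2) B_mult R_converse_closed)
  from idem(1) have "\<forall>\<^sub>F z in far. \<forall>x. (map_converse s \<circ>\<^sub>m t) z = Some x \<longrightarrow> x = z"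
    using s t by (simp add: germ_idem_iff R_comp_closed R_converse_closed)
  then show "\<forall>\<^sub>F z in far. \<forall>x y. s x = Some y \<longrightarrow> t z = Some y \<longrightarrow> x = z"
    by (rule eventually_mono) (auto simp: map_comp_Some_iff map_converse_eq_Some[OF sinj])
  from idem(2) have "\<forall>\<^sub>F z in far. \<forall>y. (s \<circ>\<^sub>m map_converse t) z = Some y \<longrightarrow> y = z"
    using s t by (simp add: germ_idem_iff R_comp_closed R_converse_closed)
  from eventually_far_image[OF t this]
  show "\<forall>\<^sub>F x in far. \<forall>y z. s x = Some y \<longrightarrow> t x = Some z \<longrightarrow> y = z"
    by (rule eventually_mono) (auto simp: map_comp_Some_iff map_converse_eq_Some[OF tinj])
qed

definition eventual_union :: "('a \<rightharpoonup> 'a) \<Rightarrow> ('a \<rightharpoonup> 'a) \<Rightarrow> ('a \<rightharpoonup> 'a) \<Rightarrow> bool" where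
  "eventual_union s t u \<longleftrightarrow> (\<forall>\<^sub>F x in far. \<forall>y. u x = Some y \<longleftrightarrow> s x = Some y \<or> t x = Some y)"

text \<open>
  Compatible germs have representatives, the restrictions to a common \<open>tail N\<close>, that are compatible
  outright, and these are glued.
\<close>
lemma eventual_union_exists:
  assumes s: "s \<in> carrier (R_monoid C)" and t: "t \<in> carrier (R_monoid C)"
    and comp: "compatible (B_monoid C) (germ s) (germ t)"
  obtains u where "u \<in> carrier (R_monoid C)" "eventual_union s t u"
proof -
  from eventually_conj[OF compatible_germs[OF s t comp]] obtain N where
    N: "\<And>x y z. x \<in> tail N \<Longrightarrow> s x = Some y \<Longrightarrow> t x = Some z \<Longrightarrow> y = z"
    "\<And>x y z. z \<in> tail N \<Longrightarrow> s x = Some y \<Longrightarrow> t z = Some y \<Longrightarrow> x = z"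
    unfolding eventually_far by blast
  have r: "(f |` tail N) x = Some y \<longleftrightarrow> x \<in> tail N \<and> f x = Some y" for f :: "'a \<rightharpoonup> 'a" and x y
    by (auto simp: restrict_map_def)
  have agree: "y = z" if "(s |` tail N) x = Some y" "(t |` tail N) x = Some z" for x y z
    using that N(1) unfolding r by blast
  have coagree: "x = z" if "(s |` tail N) x = Some y" "(t |` tail N) z = Some y" for x y z
    using that N(2) unfolding r by blast
  have carr: "s |` tail N \<in> carrier (R_monoid C)" "t |` tail N \<in> carrier (R_monoid C)"
    using s t by (auto intro: R_restrict_closed fg_tail)
  have closed: "s |` tail N ++ t |` tail N \<in> carrier (R_monoid C)"
    by (rule R_union_closed(1)[OF carr]) (fact agree coagree)+
  have union: "(s |` tail N ++ t |` tail N) x = Some y \<longleftrightarrow>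
      (s |` tail N) x = Some y \<or> (t |` tail N) x = Some y" for x y
    by (rule R_union_closed(2)[OF carr]) (fact agree coagree)+
  have "eventual_union s t (s |` tail N ++ t |` tail N)"
    unfolding eventual_union_def
    by (rule eventually_mono[OF eventually_far_tail[of N]]) (simp add: union r)
  with closed show thesis by (rule that)
qed

lemma is_join_germ:
  assumes carr: "s \<in> carrier (R_monoid C)" "t \<in> carrier (R_monoid C)" "u \<in> carrier (R_monoid C)"
    and union: "eventual_union s t u"
  shows "is_join (B_monoid C) (germ s) (germ t) (germ u)"
  unfolding is_join_def least_def
proof (intro conjI ballI)
  let ?L = "nat_order (B_monoid C)"
  have le: "x \<sqsubseteq>\<^bsub>?L\<^esub> y \<longleftrightarrow> nat_le (B_monoid C) x y" for x y by (simp add: nat_order_def)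
  have cL: "carrier ?L = germ ` carrier (R_monoid C)" by (simp add: nat_order_def B_carrier)
  show "Upper ?L {germ s, germ t} \<subseteq> carrier ?L" by (auto simp: Upper_def)
  have "\<forall>\<^sub>F x in far. \<forall>y. s x = Some y \<longrightarrow> u x = Some y"
    "\<forall>\<^sub>F x in far. \<forall>y. t x = Some y \<longrightarrow> u x = Some y"
    using union unfolding eventual_union_def by (auto elim: eventually_mono)
  then show "germ u \<in> Upper ?L {germ s, germ t}"
    using carr by (auto simp: Upper_def cL le B_nat_le_iff)
  fix X assume "X \<in> Upper ?L {germ s, germ t}"
  then obtain v where v: "v \<in> carrier (R_monoid C)" "X = germ v"
    "germ s \<sqsubseteq>\<^bsub>?L\<^esub> germ v" "germ t \<sqsubseteq>\<^bsub>?L\<^esub> germ v"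
    using carr unfolding Upper_def cL by auto
  then have "\<forall>\<^sub>F x in far. \<forall>y. s x = Some y \<longrightarrow> v x = Some y"
    "\<forall>\<^sub>F x in far. \<forall>y. t x = Some y \<longrightarrow> v x = Some y"
    using carr by (simp_all add: le B_nat_le_iff)
  with union[unfolded eventual_union_def]
  have "\<forall>\<^sub>F x in far. \<forall>y. u x = Some y \<longrightarrow> v x = Some y"
    by eventually_elim blast
  then show "germ u \<sqsubseteq>\<^bsub>?L\<^esub> X" using carr v by (simp add: le B_nat_le_iff)
qed

text \<open>
  Joins are unique, so every join is the one given by the eventual union. Hence distributivity has to
  be checked for eventual unions only, where it is a pointwise statement.
\<close>
lemma is_join_germD:
  assumes carr: "s \<in> carrier (R_monoid C)" "t \<in> carrier (R_monoid C)"
    and comp: "compatible (B_monoid C) (germ s) (germ t)"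
    and join: "is_join (B_monoid C) (germ s) (germ t) X"
  obtains u where "u \<in> carrier (R_monoid C)" "X = germ u" "eventual_union s t u"
proof -
  from eventual_union_exists[OF carr comp] obtain u where
    u: "u \<in> carrier (R_monoid C)" "eventual_union s t u" .
  note join_u = is_join_germ[OF carr u]
  from join have "X \<in> carrier (B_monoid C)"
    unfolding is_join_def least_def by (auto simp: nat_order_def)
  then obtain v where v: "v \<in> carrier (R_monoid C)" "X = germ v" unfolding B_carrier by blast
  have "nat_le (B_monoid C) X (germ u)" "nat_le (B_monoid C) (germ u) X"
    using join join_u unfolding is_join_def least_def by (auto simp: nat_order_def)
  then have "X = germ u" using B_nat_le_antisym u(1) v by simp
  with u that show thesis by blast
qed

lemma distributive_inverse_monoid_B: "distributive_inverse_monoid (B_monoid C)"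
proof -
  interpret B: inverse_monoid_zero "B_monoid C" by (rule inverse_monoid_zero_B)
  show ?thesis
  proof unfold_locales
    fix X Y assume "X \<in> carrier (B_monoid C)" "Y \<in> carrier (B_monoid C)"
      and comp: "compatible (B_monoid C) X Y"
    then obtain s t where st: "s \<in> carrier (R_monoid C)" "X = germ s"
      "t \<in> carrier (R_monoid C)" "Y = germ t" unfolding B_carrier by blast
    with comp obtain u where "u \<in> carrier (R_monoid C)" "eventual_union s t u"
      using eventual_union_exists by metis
    with st show "\<exists>Z. is_join (B_monoid C) X Y Z" using is_join_germ by blast
  next
    fix X Y Z J
    assume "X \<in> carrier (B_monoid C)" "Y \<in> carrier (B_monoid C)" "Z \<in> carrier (B_monoid C)"
      and comp: "compatible (B_monoid C) X Y" and join: "is_join (B_monoid C) X Y J"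
    then obtain s t w where st: "s \<in> carrier (R_monoid C)" "X = germ s"
      "t \<in> carrier (R_monoid C)" "Y = germ t" "w \<in> carrier (R_monoid C)" "Z = germ w"
      unfolding B_carrier by blast
    with comp join obtain u where u: "u \<in> carrier (R_monoid C)" "J = germ u" "eventual_union s t u"
      using is_join_germD by metis
    have "eventual_union (w \<circ>\<^sub>m s) (w \<circ>\<^sub>m t) (w \<circ>\<^sub>m u)"
      unfolding eventual_union_def
      by (rule eventually_mono[OF u(3)[unfolded eventual_union_def]])
        (auto simp: map_comp_Some_iff)
    then show "is_join (B_monoid C) (Z \<otimes>\<^bsub>B_monoid C\<^esub> X) (Z \<otimes>\<^bsub>B_monoid C\<^esub> Y) (Z \<otimes>\<^bsub>B_monoid C\<^esub> J)"
      using st u by (simp add: B_mult R_comp_closed is_join_germ)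
    have "eventual_union (s \<circ>\<^sub>m w) (t \<circ>\<^sub>m w) (u \<circ>\<^sub>m w)"
      unfolding eventual_union_def
      by (rule eventually_mono[OF eventually_far_image[OF st(5) u(3)[unfolded eventual_union_def]]])
        (auto simp: map_comp_Some_iff)
    then show "is_join (B_monoid C) (X \<otimes>\<^bsub>B_monoid C\<^esub> Z) (Y \<otimes>\<^bsub>B_monoid C\<^esub> Z) (J \<otimes>\<^bsub>B_monoid C\<^esub> Z)"
      using st u by (simp add: B_mult R_comp_closed is_join_germ)
  qed
qed

lemma boolean_inverse_monoid_B: "boolean_inverse_monoid (B_monoid C)"
proof -
  have "boolean_lattice ((nat_order (B_monoid C))\<lparr>carrier := idems (B_monoid C)\<rparr>)"
  proof (rule boolean_lattice_sets_mod_filter[where \<phi> = "\<lambda>J. germ (Some |` J)"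
        and \<A> = "{J. fg_right_ideal C J}" and F = far and T = "arrows C"])
    fix A B assume "A \<in> {J. fg_right_ideal C J}" "B \<in> {J. fg_right_ideal C J}"
    then have AB: "fg_right_ideal C A" "fg_right_ideal C B" by auto
    have "nat_le (B_monoid C) (germ (Some |` A)) (germ (Some |` B)) \<longleftrightarrow>
        (\<forall>\<^sub>F x in far. x \<in> A \<longrightarrow> x \<in> B)"
      unfolding B_nat_le_iff[OF AB[THEN R_id_closed]]
      by (rule eventually_cong[OF always_eventually]) (auto simp: restrict_map_def)
    then show "germ (Some |` A)
        \<sqsubseteq>\<^bsub>(nat_order (B_monoid C))\<lparr>carrier := idems (B_monoid C)\<rparr>\<^esub> germ (Some |` B) \<longleftrightarrow>
        (\<forall>\<^sub>F x in far. x \<in> A \<longrightarrow> x \<in> B)"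
      by (simp add: nat_order_def)
    show "germ (Some |` A) = germ (Some |` B) \<longleftrightarrow> (\<forall>\<^sub>F x in far. x \<in> A \<longleftrightarrow> x \<in> B)"
      unfolding germ_eq_iff[OF AB[THEN R_id_closed]]
      by (rule eventually_cong[OF always_eventually]) (auto simp: restrict_map_def)
    show "A \<union> B \<in> {J. fg_right_ideal C J}" "A \<inter> B \<in> {J. fg_right_ideal C J}"
      using AB by (auto simp: fg_Un fg_Int)
  next
    fix A assume "A \<in> {J. fg_right_ideal C J}"
    then have A: "fg_right_ideal C A" by simp
    then obtain N where "settled A N" by (rule fg_settled)
    with A have "fg_right_ideal C (tail N - A)" by (rule fg_complement)
    moreover have "\<forall>\<^sub>F x in far. x \<in> tail N - A \<longleftrightarrow> x \<notin> A"
      by (rule eventually_mono[OF eventually_far_tail[of N]]) simp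
    ultimately show "\<exists>B\<in>{J. fg_right_ideal C J}. \<forall>\<^sub>F x in far. x \<in> B \<longleftrightarrow> x \<notin> A" by blast
  qed (simp_all add: B_idems nat_order_def fg_empty fg_arrows eventually_far_arrows)
  then show ?thesis
    by (intro boolean_inverse_monoid.intro distributive_inverse_monoid_B
        boolean_inverse_monoid_axioms.intro)
qed

end


section \<open>Units and the group of essential morphisms\<close>

context finite_k_graph
begin

text \<open>
  These morphisms are at once the representatives of the units of \<open>B(C)\<close> and the elements of the
  essential part of \<open>R(C)\<close>.
\<close>
definition eventual_bijections :: "('a \<rightharpoonup> 'a) set" where
  "eventual_bijections =
    {s \<in> carrier (R_monoid C). (\<forall>\<^sub>F a in far. a \<in> dom s) \<and> (\<forall>\<^sub>F a in far. a \<in> ran s)}"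

lemma Units_B: "Units (B_monoid C) = germ ` eventual_bijections"
proof
  show "Units (B_monoid C) \<subseteq> germ ` eventual_bijections"
  proof
    fix X assume "X \<in> Units (B_monoid C)"
    then obtain s t where st: "s \<in> carrier (R_monoid C)" "X = germ s" "t \<in> carrier (R_monoid C)"
      "germ t \<otimes>\<^bsub>B_monoid C\<^esub> germ s = \<one>\<^bsub>B_monoid C\<^esub>" "germ s \<otimes>\<^bsub>B_monoid C\<^esub> germ t = \<one>\<^bsub>B_monoid C\<^esub>"
      unfolding Units_def B_carrier by blast
    then have eq: "\<forall>\<^sub>F a in far. (t \<circ>\<^sub>m s) a = (Some |` arrows C) a"
      "\<forall>\<^sub>F a in far. (s \<circ>\<^sub>m t) a = (Some |` arrows C) a"
      by (simp_all add: B_mult B_one germ_eq_iff R_comp_closed R_id_closed fg_arrows)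
    from eq(1) eventually_far_arrows have "\<forall>\<^sub>F a in far. a \<in> dom s"
      by eventually_elim (auto simp: map_comp_Some_iff)
    moreover from eq(2) eventually_far_arrows have "\<forall>\<^sub>F a in far. a \<in> ran s"
      by eventually_elim (auto simp: map_comp_Some_iff ran_def)
    ultimately show "X \<in> germ ` eventual_bijections"
      using st unfolding eventual_bijections_def by blast
  qed
  show "germ ` eventual_bijections \<subseteq> Units (B_monoid C)"
  proof clarify
    fix s assume "s \<in> eventual_bijections"
    then have s: "s \<in> carrier (R_monoid C)"
      and ev: "\<forall>\<^sub>F a in far. a \<in> dom s" "\<forall>\<^sub>F a in far. a \<in> ran s"
      unfolding eventual_bijections_def by auto
    note sinj = R_carrierD(2)[OF s] and c = R_converse_closed[OF s]
    have "\<forall>\<^sub>F a in far. (map_converse s \<circ>\<^sub>m s) a = (Some |` arrows C) a"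
      unfolding converse_comp_self[OF sinj]
      using ev(1) eventually_far_arrows by eventually_elim simp
    moreover have "\<forall>\<^sub>F a in far. (s \<circ>\<^sub>m map_converse s) a = (Some |` arrows C) a"
      unfolding self_comp_converse[OF sinj]
      using ev(2) eventually_far_arrows by eventually_elim simp
    ultimately have "germ (map_converse s) \<otimes>\<^bsub>B_monoid C\<^esub> germ s = \<one>\<^bsub>B_monoid C\<^esub>"
      "germ s \<otimes>\<^bsub>B_monoid C\<^esub> germ (map_converse s) = \<one>\<^bsub>B_monoid C\<^esub>"
      using s c by (simp_all add: B_mult B_one germ_eq_iff R_comp_closed R_id_closed fg_arrows)
    then show "germ s \<in> Units (B_monoid C)"
      unfolding Units_def using germ_closed[OF s] germ_closed[OF c] by blast
  qed
qed

lemma essential_part_carrier: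
  assumes "ids C \<noteq> {}"
  shows "carrier (essential_part (R_monoid C)) = eventual_bijections"
proof -
  have "essential (R_monoid C) (sinv (R_monoid C) s \<otimes>\<^bsub>R_monoid C\<^esub> s) \<longleftrightarrow> (\<forall>\<^sub>F a in far. a \<in> dom s)"
    "essential (R_monoid C) (s \<otimes>\<^bsub>R_monoid C\<^esub> sinv (R_monoid C) s) \<longleftrightarrow> (\<forall>\<^sub>F a in far. a \<in> ran s)"
    if "s \<in> carrier (R_monoid C)" for s
    using R_carrierD[OF that] R_essential_iff[OF _ assms] fg_ran
    by (simp_all add: R_sinv[OF that] converse_comp_self self_comp_converse)
  then show ?thesis
    unfolding essential_part_def eventual_bijections_def by auto
qed

lemma essential_part_mult [simp]: "s \<otimes>\<^bsub>essential_part (R_monoid C)\<^esub> t = s \<circ>\<^sub>m t"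
  by (simp add: essential_part_def)

lemma eventual_bijections_comp:
  assumes "s \<in> eventual_bijections" "t \<in> eventual_bijections"
  shows "s \<circ>\<^sub>m t \<in> eventual_bijections"
proof -
  from assms have carr: "s \<in> carrier (R_monoid C)" "t \<in> carrier (R_monoid C)"
    and ev: "\<forall>\<^sub>F a in far. a \<in> dom s" "\<forall>\<^sub>F a in far. a \<in> ran s"
      "\<forall>\<^sub>F a in far. a \<in> dom t" "\<forall>\<^sub>F a in far. a \<in> ran t"
    unfolding eventual_bijections_def by auto
  from ev(3) eventually_far_image[OF carr(2) ev(1)] have "\<forall>\<^sub>F a in far. a \<in> dom (s \<circ>\<^sub>m t)"
    by eventually_elim (auto simp: map_comp_Some_iff dom_def)
  moreover from ev(2) eventually_far_preimage[OF carr(1) ev(4)]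
  have "\<forall>\<^sub>F a in far. a \<in> ran (s \<circ>\<^sub>m t)"
  proof eventually_elim
    case (elim a)
    then obtain y x where "s y = Some a" "t x = Some y" unfolding ran_def by blast
    then have "(s \<circ>\<^sub>m t) x = Some a" by simp
    then show ?case by (rule ranI)
  qed
  ultimately show ?thesis
    unfolding eventual_bijections_def using R_comp_closed[OF carr] by blast
qed

lemma eventual_bijections_converse:
  assumes "s \<in> eventual_bijections"
  shows "map_converse s \<in> eventual_bijections"
proof -
  have s: "s \<in> carrier (R_monoid C)" using assms by (simp add: eventual_bijections_def)
  with assms R_converse_closed[OF s] R_carrierD(2)[OF s] show ?thesis
    by (simp add: eventual_bijections_def dom_map_converse ran_map_converse)
qed

lemma eventual_bijections_restrict_tail:
  assumes "s \<in> eventual_bijections"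
  shows "s |` tail N \<in> eventual_bijections"
proof -
  from assms have s: "s \<in> carrier (R_monoid C)"
    and ev: "\<forall>\<^sub>F a in far. a \<in> dom s" "\<forall>\<^sub>F a in far. a \<in> ran s"
    unfolding eventual_bijections_def by auto
  from ev(1) eventually_far_tail[of N] have "\<forall>\<^sub>F a in far. a \<in> dom (s |` tail N)"
    by eventually_elim simp
  moreover from ev(2) eventually_far_preimage[OF s eventually_far_tail[of N]]
  have "\<forall>\<^sub>F a in far. a \<in> ran (s |` tail N)"
  proof eventually_elim
    case (elim a)
    then obtain x where "s x = Some a" "x \<in> tail N" unfolding ran_def by blast
    then have "(s |` tail N) x = Some a" by simp
    then show ?case by (rule ranI)
  qed
  ultimately show ?thesis
    unfolding eventual_bijections_def using R_restrict_closed[OF s fg_tail] by blast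
qed

text \<open>
  Inverse and order of the essential part are computed within it; they agree with those of \<open>R(C)\<close>
  because converses of eventual bijections are eventual bijections.
\<close>
lemma essential_part_sinv:
  assumes ne: "ids C \<noteq> {}" and s: "s \<in> eventual_bijections"
  shows "sinv (essential_part (R_monoid C)) s = map_converse s"
proof -
  have sR: "s \<in> carrier (R_monoid C)" using s by (simp add: eventual_bijections_def)
  have "is_sinv (essential_part (R_monoid C)) s t \<longleftrightarrow> t = map_converse s" for t
  proof -
    have "is_sinv (essential_part (R_monoid C)) s t \<longleftrightarrow>
        t \<in> eventual_bijections \<and> is_sinv (R_monoid C) s t"
      unfolding is_sinv_def essential_part_carrier[OF ne]
      by (auto simp: eventual_bijections_def)
    then show ?thesis
      using R_is_sinv_iff[OF sR] eventual_bijections_converse[OF s] by blast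
  qed
  then show ?thesis unfolding sinv_def by (intro the_equality) simp_all
qed

lemma essential_part_nat_le:
  assumes ne: "ids C \<noteq> {}" and s: "s \<in> eventual_bijections" and t: "t \<in> eventual_bijections"
  shows "nat_le (essential_part (R_monoid C)) s t \<longleftrightarrow> s \<subseteq>\<^sub>m t"
proof -
  have carr: "s \<in> carrier (R_monoid C)" "t \<in> carrier (R_monoid C)"
    using s t by (auto simp: eventual_bijections_def)
  show ?thesis
    unfolding R_nat_le_iff[OF carr, symmetric]
    by (simp add: nat_le_def essential_part_sinv[OF ne s] R_sinv[OF carr(1)])
qed

text \<open>
  A common lower bound of \<open>s\<close> and \<open>t\<close> is defined on all long arrows, where it forces \<open>s\<close> and \<open>t\<close> to
  agree; conversely, the restriction of \<open>s\<close> to a tail on which they agree is a common lower bound.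
\<close>
lemma min_group_cong_essential_part:
  assumes ne: "ids C \<noteq> {}"
  shows "(s, t) \<in> min_group_cong (essential_part (R_monoid C)) \<longleftrightarrow>
    s \<in> eventual_bijections \<and> t \<in> eventual_bijections \<and> (\<forall>\<^sub>F a in far. s a = t a)"
proof (cases "s \<in> eventual_bijections \<and> t \<in> eventual_bijections")
  case True
  have "(\<exists>z\<in>eventual_bijections. z \<subseteq>\<^sub>m s \<and> z \<subseteq>\<^sub>m t) \<longleftrightarrow> (\<forall>\<^sub>F a in far. s a = t a)"
  proof
    assume "\<exists>z\<in>eventual_bijections. z \<subseteq>\<^sub>m s \<and> z \<subseteq>\<^sub>m t"
    then obtain z where z: "z \<in> eventual_bijections" "z \<subseteq>\<^sub>m s" "z \<subseteq>\<^sub>m t" by blast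
    then have "\<forall>\<^sub>F a in far. a \<in> dom z" by (simp add: eventual_bijections_def)
    then show "\<forall>\<^sub>F a in far. s a = t a"
      by (rule eventually_mono) (use z(2,3) in \<open>metis map_le_def\<close>)
  next
    assume "\<forall>\<^sub>F a in far. s a = t a"
    then obtain N where N: "\<And>a. a \<in> tail N \<Longrightarrow> s a = t a" unfolding eventually_far by blast
    have "s |` tail N \<subseteq>\<^sub>m s" "s |` tail N \<subseteq>\<^sub>m t" using N by (auto simp: map_le_def)
    then show "\<exists>z\<in>eventual_bijections. z \<subseteq>\<^sub>m s \<and> z \<subseteq>\<^sub>m t"
      using True eventual_bijections_restrict_tail by blast
  qed
  with True show ?thesis
    by (simp add: min_group_cong_def essential_part_carrier[OF ne] essential_part_nat_le[OF ne]
        cong: bex_cong)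
next
  case False
  then show ?thesis by (auto simp: min_group_cong_def essential_part_carrier[OF ne])
qed

text \<open>
  The Lenz class of an eventual bijection contains eventual bijections only, so it does not grow when
  the congruence is taken on all of \<open>R(C)\<close>.
\<close>
lemma min_group_class:
  assumes "ids C \<noteq> {}" and s: "s \<in> eventual_bijections"
  shows "min_group_cong (essential_part (R_monoid C)) `` {s} = germ s"
proof -
  have "t \<in> eventual_bijections"
    if t: "t \<in> carrier (R_monoid C)" and eq: "\<forall>\<^sub>F a in far. s a = t a" for t
  proof -
    have sR: "s \<in> carrier (R_monoid C)" and ev: "\<forall>\<^sub>F a in far. a \<in> dom s" "\<forall>\<^sub>F a in far. a \<in> ran s"
      using s by (auto simp: eventual_bijections_def)
    from ev(1) eq have "\<forall>\<^sub>F a in far. a \<in> dom t" by eventually_elim (simp add: dom_def)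
    moreover from ev(2) eventually_far_preimage[OF sR eq] have "\<forall>\<^sub>F a in far. a \<in> ran t"
    proof eventually_elim
      case (elim a)
      then obtain x where "s x = Some a" "s x = t x" unfolding ran_def by blast
      then show ?case by (intro ranI) simp
    qed
    ultimately show ?thesis using t by (simp add: eventual_bijections_def)
  qed
  then show ?thesis
    using s unfolding germ_def
    by (auto simp: min_group_cong_essential_part[OF assms(1)] lenz_cong_iff eventual_bijections_def)
qed

lemma G_group_eq:
  assumes ne: "ids C \<noteq> {}"
  shows "carrier (G_group C) = germ ` eventual_bijections"
    and "\<lbrakk>s \<in> eventual_bijections; t \<in> eventual_bijections\<rbrakk>
      \<Longrightarrow> germ s \<otimes>\<^bsub>G_group C\<^esub> germ t = germ (s \<circ>\<^sub>m t)"
proof -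
  let ?S = "essential_part (R_monoid C)"
  let ?r = "min_group_cong ?S"
  note r = min_group_cong_essential_part[OF ne] and carr = essential_part_carrier[OF ne]
  have class_eq: "?r `` {s} = germ s" if "s \<in> eventual_bijections" for s
    using min_group_class[OF ne that] .
  show "carrier (G_group C) = germ ` eventual_bijections"
    by (auto simp: G_group_def Let_def quotient_monoid_def quotient_def carr class_eq)
  have "equiv (carrier ?S) ?r"
    unfolding carr
  proof (rule equivI)
    show "?r \<subseteq> eventual_bijections \<times> eventual_bijections" by (auto simp: r)
    show "refl_on eventual_bijections ?r" by (rule refl_onI) (simp add: r)
    show "sym ?r" by (rule symI) (simp add: r eq_commute)
    show "trans ?r"
    proof (rule transI)
      fix x y z assume "(x, y) \<in> ?r" "(y, z) \<in> ?r"
      then show "(x, z) \<in> ?r" unfolding r by (auto elim: eventually_elim2)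
    qed
  qed
  moreover have "(a \<otimes>\<^bsub>?S\<^esub> b, a' \<otimes>\<^bsub>?S\<^esub> b') \<in> ?r" if "(a, a') \<in> ?r" "(b, b') \<in> ?r" for a a' b b'
  proof -
    have "(a, a') \<in> lenz_cong (R_monoid C)" "(b, b') \<in> lenz_cong (R_monoid C)"
      using that by (auto simp: r lenz_cong_iff eventual_bijections_def)
    then have "(a \<circ>\<^sub>m b, a' \<circ>\<^sub>m b') \<in> lenz_cong (R_monoid C)"
      using lenz_cong_mult[of a a' b b'] by simp
    with that show ?thesis by (auto simp: r lenz_cong_iff eventual_bijections_comp)
  qed
  ultimately show "germ s \<otimes>\<^bsub>G_group C\<^esub> germ t = germ (s \<circ>\<^sub>m t)"
    if "s \<in> eventual_bijections" "t \<in> eventual_bijections"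
    using quotient_monoid_mult[of ?S ?r s t] that
    by (simp add: G_group_def Let_def carr class_eq eventual_bijections_comp)
qed

lemma units_B_iso_G:
  assumes "ids C \<noteq> {}"
  shows "units_of (B_monoid C) \<cong> G_group C"
proof (rule is_isoI)
  have "germ s \<otimes>\<^bsub>B_monoid C\<^esub> germ t = germ s \<otimes>\<^bsub>G_group C\<^esub> germ t"
    if "s \<in> eventual_bijections" "t \<in> eventual_bijections" for s t
    using that G_group_eq(2)[OF assms that] by (simp add: B_mult eventual_bijections_def)
  then show "id \<in> iso (units_of (B_monoid C)) (G_group C)"
    by (auto simp: iso_def hom_def units_of_def Units_B G_group_eq(1)[OF assms])
qed

end


section \<open>The Boolean inverse monoid and its group of units\<close>

theorem theorem6p15:
  fixes C :: "('a, 'z) arrow_cat_scheme" and k :: nat and d :: "'a \<Rightarrow> nat \<Rightarrow> nat"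
  assumes "k_graph C k d"
    and "finite (ids C)" and "ids C \<noteq> {}"
    and "no_sources C k d"
    and "row_finite C k d"
  shows "boolean_inverse_monoid (B_monoid C) \<and> units_of (B_monoid C) \<cong> G_group C"
proof -
  interpret finite_k_graph C k d
    using assms by (simp add: finite_k_graph_def finite_k_graph_axioms_def)
  show ?thesis
    using boolean_inverse_monoid_B units_B_iso_G[OF assms(3)] by blast
qed

end
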